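(* Let $p\ge2$. The tightness potential $TP:P_p(\mathbb{R}^d)\to\mathbb{R}$ is a regular functional on $P_p(\mathbb{R}^d)$.
   Context: $P_p(\mathbb{R}^d)$ is the set of Borel probability measures on $\mathbb{R}^d$ with finite $p$-th moment, with the $p$-Wasserstein distance $W_p$. $TP(\mu)=\iint\big[\langle x,y\rangle^2-\tfrac1d\|x\|^2\|y\|^2\big]\,d\mu(x)\,d\mu(y)$. Let $q=p/(p-1)$ and for $\gamma\in P(\mathbb{R}^d\times\mathbb{R}^d)$ let $|\gamma|_{j,r}=\big(\iint\|x_j\|^r d\gamma(x_1,x_2)\big)^{1/r}$; $P_{pq}(\mathbb{R}^d\times\mathbb{R}^d)$ is the set of $\gamma$ with $|\gamma|_{1,p}+|\gamma|_{2,q}<\infty$. For such $\gamma$ with $\pi^1_\#\gamma=\mu$ and $\nu\in P_p(\mathbb{R}^d)$, $\Gamma(\gamma,\nu)$ is the set of probability measures $\beta$ on $(\mathbb{R}^d)^3$ with $(\pi^1,\pi^2)_\#\beta=\gamma$, $\pi^3_\#\beta=\nu$; $\Gamma_0(\gamma,\nu)$ is the subset of those $\beta$ for which $(\pi^1,\pi^3)_\#\beta$ is an optimal coupling for $W_p(\mu,\nu)$; and $C_{p,\beta}(\mu,\nu)=\big(\iiint\|x_1-x_3\|^pd\beta\big)^{1/p}$. For a proper lower semicontinuous $\phi:P_p(\mathbb{R}^d)\to(-\infty,\infty]$ and $\mu$ with $\phi(\mu)<\infty$, $\gamma\in P_{pq}(\mathbb{R}^d\times\mathbb{R}^d)$ with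 $\pi^1_\#\gamma=\mu$ belongs to the extended Fréchet subdifferential $\partial_S\phi(\mu)$ if $\phi(\nu)-\phi(\mu)\ge\inf_{\beta\in\Gamma_0(\gamma,\nu)}\iiint\langle x_2,x_3-x_1\rangle\,d\beta+o(W_p(\mu,\nu))$ as $\nu\to\mu$ in $P_p$; it is a strong Fréchet subdifferential if $\phi(\nu)-\phi(\mu)\ge\iiint\langle x_2,x_3-x_1\rangle\,d\beta+o(C_{p,\beta}(\mu,\nu))$ for every $\nu$ and every $\beta\in\Gamma(\gamma,\nu)$. Such a $\phi$ is regular if whenever $\gamma_n$ are strong Fréchet subdifferentials of $\phi$ at $\mu_n$ with $\phi(\mu_n)\to\varphi\in\mathbb{R}$, $\mu_n\to\mu$ in $P_p(\mathbb{R}^d)$, $\sup_n|\gamma_n|_{2,q}<\infty$, and $\gamma_n\to\gamma$ narrowly in $P(\mathbb{R}^d\times\mathbb{R}^d)$, then $\gamma\in\partial_S\phi(\mu)$ and $\varphi=\phi(\mu)$. *)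

theory Defs
  imports "HOL-Probability.Probability"
begin

definition Pp :: "real \<Rightarrow> 'a::euclidean_space measure set" where
  "Pp p = {\<mu>. prob_space \<mu> \<and> sets \<mu> = sets borel \<and>
              (\<integral>\<^sup>+ x. ennreal (norm x powr p) \<partial>\<mu>) < \<infinity>}"

definition couplings :: "'a::euclidean_space measure \<Rightarrow> 'a measure \<Rightarrow> ('a \<times> 'a) measure set" where
  "couplings \<mu> \<nu> = {\<pi>. prob_space \<pi> \<and> sets \<pi> = sets borel \<and>
        distr \<pi> borel fst = \<mu> \<and> distr \<pi> borel snd = \<nu>}"

definition transport_cost :: "real \<Rightarrow> ('a::euclidean_space \<times> 'a) measure \<Rightarrow> ennreal" where
  "transport_cost p \<pi> = (\<integral>\<^sup>+ z. ennreal (norm (fst z - snd z) powr p) \<partial>\<pi>)"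

definition Wp :: "real \<Rightarrow> 'a::euclidean_space measure \<Rightarrow> 'a measure \<Rightarrow> real" where
  "Wp p \<mu> \<nu> = enn2real (INF \<pi>\<in>couplings \<mu> \<nu>. transport_cost p \<pi>) powr (1 / p)"

definition optimal_couplings :: "real \<Rightarrow> 'a::euclidean_space measure \<Rightarrow> 'a measure \<Rightarrow> ('a \<times> 'a) measure set" where
  "optimal_couplings p \<mu> \<nu> = {\<pi> \<in> couplings \<mu> \<nu>.
       transport_cost p \<pi> = (INF \<pi>'\<in>couplings \<mu> \<nu>. transport_cost p \<pi>')}"

definition conv_Pp :: "real \<Rightarrow> (nat \<Rightarrow> 'a::euclidean_space measure) \<Rightarrow> 'a measure \<Rightarrow> bool" where
  "conv_Pp p \<mu>s \<mu> \<longleftrightarrow> (\<forall>n. \<mu>s n \<in> Pp p) \<and> \<mu> \<in> Pp p \<and> (\<lambda>n. Wp p (\<mu>s n) \<mu>) \<longlonglongrightarrow> 0"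

definition TP :: "'a::euclidean_space measure \<Rightarrow> ereal" where
  "TP \<mu> = ereal (\<integral> x. (\<integral> y. (inner x y)\<^sup>2 - (1 / real DIM('a)) * (norm x)\<^sup>2 * (norm y)\<^sup>2 \<partial>\<mu>) \<partial>\<mu>)"

definition gnorm1 :: "real \<Rightarrow> ('a::euclidean_space \<times> 'a) measure \<Rightarrow> real" where
  "gnorm1 r \<gamma> = enn2real (\<integral>\<^sup>+ z. ennreal (norm (fst z) powr r) \<partial>\<gamma>) powr (1 / r)"

definition gnorm2 :: "real \<Rightarrow> ('a::euclidean_space \<times> 'a) measure \<Rightarrow> real" where
  "gnorm2 r \<gamma> = enn2real (\<integral>\<^sup>+ z. ennreal (norm (snd z) powr r) \<partial>\<gamma>) powr (1 / r)"

definition conj_exp :: "real \<Rightarrow> real" where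
  "conj_exp p = p / (p - 1)"

definition Ppq :: "real \<Rightarrow> ('a::euclidean_space \<times> 'a) measure set" where
  "Ppq p = {\<gamma>. prob_space \<gamma> \<and> sets \<gamma> = sets borel \<and>
     (\<integral>\<^sup>+ z. ennreal (norm (fst z) powr p) \<partial>\<gamma>) < \<infinity> \<and>
     (\<integral>\<^sup>+ z. ennreal (norm (snd z) powr conj_exp p) \<partial>\<gamma>) < \<infinity>}"

definition Gamma3 :: "('a::euclidean_space \<times> 'a) measure \<Rightarrow> 'a measure \<Rightarrow> ('a \<times> 'a \<times> 'a) measure set" where
  "Gamma3 \<gamma> \<nu> = {\<beta>. prob_space \<beta> \<and> sets \<beta> = sets borel \<and>
      distr \<beta> borel (\<lambda>(x1, x2, x3). (x1, x2)) = \<gamma> \<and>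
      distr \<beta> borel (\<lambda>(x1, x2, x3). x3) = \<nu>}"

definition Gamma3_0 :: "real \<Rightarrow> ('a::euclidean_space \<times> 'a) measure \<Rightarrow> 'a measure \<Rightarrow> ('a \<times> 'a \<times> 'a) measure set" where
  "Gamma3_0 p \<gamma> \<nu> = {\<beta> \<in> Gamma3 \<gamma> \<nu>.
      distr \<beta> borel (\<lambda>(x1, x2, x3). (x1, x3)) \<in> optimal_couplings p (distr \<gamma> borel fst) \<nu>}"

definition Cpb :: "real \<Rightarrow> ('a::euclidean_space \<times> 'a \<times> 'a) measure \<Rightarrow> real" where
  "Cpb p \<beta> = enn2real (\<integral>\<^sup>+ z. ennreal (norm (fst z - snd (snd z)) powr p) \<partial>\<beta>) powr (1 / p)"

definition pairing3 :: "('a::euclidean_space \<times> 'a \<times> 'a) measure \<Rightarrow> real" where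
  "pairing3 \<beta> = (\<integral> z. inner (fst (snd z)) (snd (snd z) - fst z) \<partial>\<beta>)"

definition ext_subdiff :: "real \<Rightarrow> ('a::euclidean_space measure \<Rightarrow> ereal) \<Rightarrow> 'a measure \<Rightarrow> ('a \<times> 'a) measure set" where
  "ext_subdiff p \<phi> \<mu> = {\<gamma>. \<mu> \<in> Pp p \<and> \<phi> \<mu> < \<infinity> \<and> \<gamma> \<in> Ppq p \<and> distr \<gamma> borel fst = \<mu> \<and>
     (\<forall>\<epsilon>>0. \<exists>\<delta>>0. \<forall>\<nu>\<in>Pp p. Wp p \<mu> \<nu> < \<delta> \<longrightarrow>
        \<phi> \<nu> - \<phi> \<mu> \<ge> (INF \<beta>\<in>Gamma3_0 p \<gamma> \<nu>. ereal (pairing3 \<beta>)) - ereal (\<epsilon> * Wp p \<mu> \<nu>))}"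

definition strong_frechet :: "real \<Rightarrow> ('a::euclidean_space measure \<Rightarrow> ereal) \<Rightarrow> 'a measure \<Rightarrow> ('a \<times> 'a) measure \<Rightarrow> bool" where
  "strong_frechet p \<phi> \<mu> \<gamma> \<longleftrightarrow> \<mu> \<in> Pp p \<and> \<phi> \<mu> < \<infinity> \<and> \<gamma> \<in> Ppq p \<and> distr \<gamma> borel fst = \<mu> \<and>
     (\<forall>\<epsilon>>0. \<exists>\<delta>>0. \<forall>\<nu>\<in>Pp p. \<forall>\<beta>\<in>Gamma3 \<gamma> \<nu>. Cpb p \<beta> < \<delta> \<longrightarrow>
        \<phi> \<nu> - \<phi> \<mu> \<ge> ereal (pairing3 \<beta>) - ereal (\<epsilon> * Cpb p \<beta>))"

definition narrow_conv :: "(nat \<Rightarrow> ('a::euclidean_space \<times> 'a) measure) \<Rightarrow> ('a \<times> 'a) measure \<Rightarrow> bool" where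
  "narrow_conv \<gamma>s \<gamma> \<longleftrightarrow> (\<forall>n. prob_space (\<gamma>s n) \<and> sets (\<gamma>s n) = sets borel) \<and>
     prob_space \<gamma> \<and> sets \<gamma> = sets borel \<and>
     (\<forall>f :: 'a \<times> 'a \<Rightarrow> real. continuous_on UNIV f \<and> bounded (range f) \<longrightarrow>
        (\<lambda>n. \<integral> z. f z \<partial>\<gamma>s n) \<longlonglongrightarrow> (\<integral> z. f z \<partial>\<gamma>))"

definition proper_lsc :: "real \<Rightarrow> ('a::euclidean_space measure \<Rightarrow> ereal) \<Rightarrow> bool" where
  "proper_lsc p \<phi> \<longleftrightarrow> (\<forall>\<mu>\<in>Pp p. \<phi> \<mu> \<noteq> -\<infinity>) \<and> (\<exists>\<mu>\<in>Pp p. \<phi> \<mu> < \<infinity>) \<and>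
     (\<forall>\<mu>s \<mu>. conv_Pp p \<mu>s \<mu> \<longrightarrow> \<phi> \<mu> \<le> liminf (\<lambda>n. \<phi> (\<mu>s n)))"

text \<open>Regular functional (defined for proper lsc functionals; properness and
  lower semicontinuity are included as part of the notion)\<close>
definition regular_functional :: "real \<Rightarrow> ('a::euclidean_space measure \<Rightarrow> ereal) \<Rightarrow> bool" where
  "regular_functional p \<phi> \<longleftrightarrow> proper_lsc p \<phi> \<and>
     (\<forall>\<mu>s \<gamma>s (c::real) \<mu> \<gamma>.
        (\<forall>n. strong_frechet p \<phi> (\<mu>s n) (\<gamma>s n)) \<and>
        (\<lambda>n. \<phi> (\<mu>s n)) \<longlonglongrightarrow> ereal c \<and>
        conv_Pp p \<mu>s \<mu> \<and>
        bdd_above (range (\<lambda>n. gnorm2 (conj_exp p) (\<gamma>s n))) \<and>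
        narrow_conv \<gamma>s \<gamma>
      \<longrightarrow> \<gamma> \<in> ext_subdiff p \<phi> \<mu> \<and> ereal c = \<phi> \<mu>)"

end

theory Submission
  imports Defs
begin

text \<open>
  TP is a quadratic form in the second moments, hence continuous and smooth along couplings: its
  gradient at \<open>\<mu>\<close> is a linear vector field \<open>G\<^sub>\<mu>\<close>, with an error that is
  quadratic in the transport distance. Perturbing \<open>x\<^sub>1\<close> in the direction of
  \<open>x\<^sub>2 - G\<^sub>\<mu>(x\<^sub>1)\<close> shows that a strong subdifferential at \<open>\<mu>\<close> is concentrated on
  the graph of \<open>G\<^sub>\<mu>\<close>. Since \<open>G\<^sub>\<mu>\<close> depends only on the second moments, this property passes to the
  limit, and the graph plan satisfies the subdifferential inequality along every optimal coupling.

  The infimum over optimal plans is \<open>\<infinity>\<close> when there are none, so optimal couplings must exist. Their weak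
  compactness is reduced to Helly's theorem on the line: a continuous surjection of the line onto the
  space with a Borel section that maps bounded sets to bounded sets lifts tight sequences.
\<close>

section \<open>A space-filling curve with a Borel section\<close>

text \<open>The strong notion tests every plan in \<open>Gamma3\<close>, so the displacement may
  depend on \<open>x2\<close> as well as on \<open>x1\<close>. This freedom excludes any mass off
  the graph of the gradient. Membership in \<open>ext_subdiff\<close> only asks for an upper bound
  on an infimum, so a single optimal plan suffices there. The remainder of the expansion is measured
  in mean square, the subdifferentials in p-th mean. The assumption \<open>p \<ge> 2\<close> bounds
  the former by a constant times the latter, and it makes second moments continuous under
  \<open>Wp\<close>. The estimates divide by the size of the displacement, which may vanish. They
  therefore carry a positive upper bound for it, and the case of distance zero is reached by letting
  this bound shrink.\<close>

definition schoenberg_clip :: "real \<Rightarrow> real" where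
  "schoenberg_clip t = max 0 (min 1 (1/2 - cos (pi * t)))"

lemma schoenberg_clip_bounds: "0 \<le> schoenberg_clip t" "schoenberg_clip t \<le> 1"
  by (auto simp: schoenberg_clip_def)

lemma continuous_on_schoenberg_clip [continuous_intros]:
  fixes f :: "'a::t2_space \<Rightarrow> real"
  shows "continuous_on S f \<Longrightarrow> continuous_on S (\<lambda>x. schoenberg_clip (f x))"
  unfolding schoenberg_clip_def by (intro continuous_intros)

lemma schoenberg_clip_periodic: "schoenberg_clip (2 * of_nat n + t) = schoenberg_clip t"
proof -
  have "pi * (2 * of_nat n + t) = pi * t + of_int (int n) * (2 * pi)" by (simp add: algebra_simps)
  then have "cos (pi * (2 * of_nat n + t)) = cos (pi * t)"
    using cos.plus_of_int[of "pi * t" "int n"] by simp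
  then show ?thesis by (simp add: schoenberg_clip_def)
qed

lemma schoenberg_clip_eq_0:
  assumes "0 \<le> t" "t \<le> 1/3" shows "schoenberg_clip t = 0"
proof -
  have "cos (pi / 3) \<le> cos (pi * t)"
    using assms by (intro cos_monotone_0_pi_le) (auto simp: field_simps)
  then show ?thesis by (auto simp: schoenberg_clip_def cos_60)
qed

lemma schoenberg_clip_eq_1:
  assumes "2/3 \<le> t" "t \<le> 1" shows "schoenberg_clip t = 1"
proof -
  have "cos (pi * t) \<le> cos (2 * pi / 3)"
    using assms by (intro cos_monotone_0_pi_le) (auto simp: field_simps)
  also have "cos (2 * pi / 3) = - cos (pi / 3)"
    using cos_pi_minus[of "pi/3"] by (simp add: field_simps)
  finally show ?thesis by (auto simp: schoenberg_clip_def cos_60)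
qed

text \<open>The point of the ternary Cantor set with digits \<open>2 * a k\<close>, each 0 or 2 when
  \<open>a\<close> takes the values 0 and 1.\<close>

definition cantor_point :: "(nat \<Rightarrow> nat) \<Rightarrow> real" where
  "cantor_point a = (\<Sum>k. 2 * real (a k) * (1/3) ^ Suc k)"

lemma cantor_point_summable:
  assumes "\<And>k. a k \<le> 1"
  shows "summable (\<lambda>k. 2 * real (a k) * (1/3) ^ Suc k)"
proof (rule summable_comparison_test)
  show "\<exists>N. \<forall>n\<ge>N. norm (2 * real (a n) * (1/3) ^ Suc n) \<le> 2 * (1/3) ^ Suc n"
    using assms by (auto intro!: exI[of _ 0] mult_right_mono)
  show "summable (\<lambda>n. 2 * (1/3 :: real) ^ Suc n)"
    by (intro summable_mult) (auto intro!: summable_geometric simp: summable_Suc_iff)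
qed

lemma cantor_point_bounds:
  assumes "\<And>k. a k \<le> 1"
  shows "0 \<le> cantor_point a" "cantor_point a \<le> 1"
proof -
  show "0 \<le> cantor_point a"
    unfolding cantor_point_def by (intro suminf_nonneg cantor_point_summable assms) auto
  have s: "(\<lambda>n. (2/3) * (1/3 :: real) ^ n) sums ((2/3) * (1 / (1 - 1/3)))"
    by (intro sums_mult geometric_sums) auto
  then have s: "(\<lambda>n. 2 * (1/3 :: real) ^ Suc n) sums 1" by simp
  have "cantor_point a \<le> (\<Sum>k. 2 * (1/3) ^ Suc k)"
    unfolding cantor_point_def using assms
    by (intro suminf_le cantor_point_summable assms sums_summable[OF s])
       (auto intro!: mult_right_mono)
  then show "cantor_point a \<le> 1" using sums_unique[OF s] by simp
qed

lemma cantor_point_shift: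
  assumes "\<And>k. a k \<le> 1"
  shows "3 * cantor_point a = 2 * real (a 0) + cantor_point (\<lambda>k. a (Suc k))"
proof -
  have "cantor_point a = 2 * real (a 0) / 3 + (\<Sum>k. 2 * real (a (Suc k)) * (1/3) ^ Suc (Suc k))"
    unfolding cantor_point_def using suminf_split_head[OF cantor_point_summable[of a, OF assms]] by simp
  also have "(\<Sum>k. 2 * real (a (Suc k)) * (1/3) ^ Suc (Suc k)) =
      (\<Sum>k. (1/3) * (2 * real (a (Suc k)) * (1/3) ^ Suc k))" by (simp add: mult_ac)
  also have "\<dots> = (1/3) * cantor_point (\<lambda>k. a (Suc k))"
    unfolding cantor_point_def by (rule suminf_mult) (intro cantor_point_summable[of "\<lambda>k. a (Suc k)"] assms)
  finally show ?thesis by simp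
qed

text \<open>The clipped cosine has period 2, vanishes on [0,1/3] and equals 1 on [2/3,1], so it
  reads the leading digit of a Cantor point. Multiplication by 3 shifts the digits and turns the
  even integer \<open>2 * K\<close> into \<open>2 * (3 * K + a 0)\<close>, hence the induction over
  arbitrary \<open>K\<close>.\<close>

lemma schoenberg_clip_digit:
  assumes "\<And>k. a k \<le> 1"
  shows "schoenberg_clip (3 ^ m * (2 * of_nat K + cantor_point a)) = a m"
  using assms
proof (induction m arbitrary: a K)
  case 0
  have b: "0 \<le> cantor_point (\<lambda>k. a (Suc k))" "cantor_point (\<lambda>k. a (Suc k)) \<le> 1"
    using cantor_point_bounds[of "\<lambda>k. a (Suc k)"] 0 by auto
  have "a 0 = 0 \<or> a 0 = 1" using 0[of 0] by auto
  then have "schoenberg_clip (cantor_point a) = a 0"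
    using cantor_point_shift[of a, OF 0] b
    by (auto intro!: schoenberg_clip_eq_0 schoenberg_clip_eq_1)
  then show ?case by (simp add: schoenberg_clip_periodic)
next
  case (Suc m)
  have e: "3 ^ Suc m * (2 * of_nat K + cantor_point a)
     = 3 ^ m * (2 * of_nat (3 * K + a 0) + cantor_point (\<lambda>k. a (Suc k)))"
  proof -
    have "3 ^ Suc m * (2 * of_nat K + cantor_point a) = 3 ^ m * (2 * of_nat (3 * K) + 3 * cantor_point a)"
      by (simp add: algebra_simps)
    also have "\<dots> = 3 ^ m * (2 * of_nat (3 * K) + (2 * real (a 0) + cantor_point (\<lambda>k. a (Suc k))))"
      by (subst cantor_point_shift[of a, OF Suc.prems]) simp
    finally show ?thesis by (simp add: algebra_simps)
  qed
  show ?case unfolding e using Suc.prems by (subst Suc.IH) auto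
qed

section \<open>Binary digits, and a continuous function with integer plateaus\<close>

lemma binary_expansion:
  fixes x :: real
  assumes "0 \<le> x" "x \<le> 1"
  obtains a :: "nat \<Rightarrow> nat" where "\<And>k. a k \<le> 1" "(\<lambda>k. real (a k) * (1/2) ^ Suc k) sums x"
proof -
  define d :: "real \<Rightarrow> nat" where "d r = (if r \<ge> 1/2 then 1 else 0)" for r
  define r where "r = rec_nat x (\<lambda>_ r. 2 * r - real (d r))"
  have r0: "r 0 = x" and rS: "\<And>k. r (Suc k) = 2 * r k - real (d (r k))" by (simp_all add: r_def)
  \<comment> \<open>The value 1 is a fixed point of the remainder map, so the expansion of 1
    consists of ones and the right endpoint needs no special case.\<close>
  have rb: "0 \<le> r k \<and> r k \<le> 1" for k
    by (induction k) (use assms in \<open>auto simp: r0 rS d_def\<close>)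
  have part: "(\<Sum>k<n. real (d (r k)) * (1/2) ^ Suc k) = x - r n * (1/2) ^ n" for n
    by (induction n) (auto simp: r0 rS field_simps)
  have "(\<lambda>n. r n * (1/2) ^ n) \<longlonglongrightarrow> 0"
  proof (rule tendsto_sandwich[of "\<lambda>_. 0" _ _ "\<lambda>n. (1/2)^n"])
    show "\<forall>\<^sub>F n in sequentially. r n * (1/2) ^ n \<le> (1/2) ^ n"
      using rb by (intro always_eventually) (auto intro!: mult_left_le_one_le)
    show "(\<lambda>n. (1/2 :: real) ^ n) \<longlonglongrightarrow> 0" by (intro LIMSEQ_power_zero) auto
  qed (use rb in auto)
  then have "(\<lambda>n. x - r n * (1/2) ^ n) \<longlonglongrightarrow> x - 0" by (intro tendsto_intros)
  then have "(\<lambda>k. real (d (r k)) * (1/2) ^ Suc k) sums x"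
    unfolding sums_def part by simp
  then show thesis by (intro that[of "\<lambda>k. d (r k)"]) (auto simp: d_def)
qed

text \<open>\<open>arccos (cos (pi * t)) / pi\<close> is the distance from \<open>t\<close> to the
  nearest even integer. The function is thus constant \<open>K\<close> on \<open>[2K, 2K+1]\<close>
  and rises linearly on \<open>[2K+1, 2K+2]\<close>.\<close>

definition plateau :: "real \<Rightarrow> real" where
  "plateau t = (t - arccos (cos (pi * t)) / pi) / 2"

lemma continuous_on_plateau: "continuous_on UNIV plateau"
  unfolding plateau_def by (intro continuous_intros) auto

lemma plateau_eq:
  assumes "0 \<le> t" "t \<le> 1" shows "plateau (2 * of_nat K + t) = real K"
proof -
  have "pi * (2 * of_nat K + t) = pi * t + of_int (int K) * (2 * pi)" by (simp add: algebra_simps)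
  then have "cos (pi * (2 * of_nat K + t)) = cos (pi * t)"
    using cos.plus_of_int[of "pi * t" "int K"] by simp
  then show ?thesis using assms
    by (simp add: plateau_def arccos_cos)
qed

text \<open>Schoenberg's space-filling curve, scaled by a plateau function so that it covers the whole
  space and each bounded set is already covered by a bounded set of parameters.\<close>

lemma proper_space_filling_curve:
  obtains g :: "real \<Rightarrow> 'b::euclidean_space"
  where "continuous_on UNIV g" "\<And>z. \<exists>t. 0 \<le> t \<and> t \<le> 2 * norm z + 5 \<and> g t = z"
proof -
  define N where "N = DIM('b)"
  have N: "N > 0" by (simp add: N_def)
  obtain e :: "nat \<Rightarrow> 'b" where e: "bij_betw e {0..<N} Basis"
    using ex_bij_betw_nat_finite[of "Basis :: 'b set"] by (auto simp: N_def)
  \<comment> \<open>The coordinate \<open>i\<close> uses the ternary digits whose index is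
    \<open>i\<close> modulo \<open>N\<close>, so one parameter encodes \<open>N\<close> binary
    expansions.\<close>
  define c where "c i t = (\<Sum>k. schoenberg_clip (3 ^ (N * k + i) * t) * (1/2) ^ Suc k)" for i t
  define g where "g t = (\<Sum>i<N. (plateau t * (2 * c i t - 1)) *\<^sub>R e i)" for t
  have cc: "continuous_on UNIV (c i)" for i
  proof (rule uniform_limit_theorem)
    show "uniform_limit UNIV (\<lambda>n t. \<Sum>k<n. schoenberg_clip (3 ^ (N * k + i) * t) * (1/2) ^ Suc k) (c i) sequentially"
      unfolding c_def using schoenberg_clip_bounds
    proof (intro Weierstrass_m_test)
      show "summable (\<lambda>k. (1/2 :: real) ^ Suc k)" using power_half_series by (rule sums_summable)
      show "norm (schoenberg_clip (3 ^ (N * n + i) * t) * (1 / 2) ^ Suc n) \<le> (1 / 2) ^ Suc n" for n t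
        using schoenberg_clip_bounds[of "3 ^ (N * n + i) * t"]
        by (auto simp: abs_mult intro!: mult_left_le_one_le)
    qed
    show "\<forall>\<^sub>F n in sequentially. continuous_on UNIV (\<lambda>t. \<Sum>k<n. schoenberg_clip (3 ^ (N * k + i) * t) * (1/2) ^ Suc k)"
      by (intro always_eventually allI continuous_intros)
  qed simp
  have "continuous_on UNIV g"
    unfolding g_def by (intro continuous_intros continuous_on_plateau cc)
  moreover have "\<exists>t. 0 \<le> t \<and> t \<le> 2 * norm z + 5 \<and> g t = z" for z
  proof -
    \<comment> \<open>The height \<open>K\<close> dominates all coordinates of \<open>z\<close>, and
      the added 1 keeps it positive at \<open>z = 0\<close>. As \<open>K \<le> norm z + 2\<close>
      and the parameter lies in \<open>[2K, 2K+1]\<close>, the bound \<open>2 * norm z + 5\<close>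
      results.\<close>
    define K where "K = nat \<lceil>norm z\<rceil> + 1"
    have K: "norm z \<le> real K" "real K \<le> norm z + 2" "real K > 0"
      unfolding K_def using norm_ge_zero[of z] by (auto, linarith+)
    define x where "x i = (z \<bullet> e i / K + 1) / 2" for i
    have "\<exists>a :: nat \<Rightarrow> nat. (\<forall>k. a k \<le> 1) \<and> (\<lambda>k. real (a k) * (1/2) ^ Suc k) sums (x i)" if "i < N" for i
    proof -
      have eB: "e i \<in> Basis" using e that by (auto simp: bij_betw_def)
      have "\<bar>z \<bullet> e i\<bar> \<le> K" using Basis_le_norm[OF eB, of z] K by simp
      then have "0 \<le> x i" "x i \<le> 1" using K by (auto simp: x_def field_simps)
      then show ?thesis using binary_expansion by metis
    qed
    then obtain A :: "nat \<Rightarrow> nat \<Rightarrow> nat" where A: "\<And>i k. i < N \<Longrightarrow> A i k \<le> 1"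
        "\<And>i. i < N \<Longrightarrow> (\<lambda>k. real (A i k) * (1/2) ^ Suc k) sums (x i)"
      by metis
    \<comment> \<open>Interleaving of the \<open>N\<close> digit sequences, inverse to the splitting
      in \<open>c\<close>.\<close>
    define a where "a m = A (m mod N) (m div N)" for m
    have a1: "a m \<le> 1" for m using A(1)[of "m mod N"] N by (simp add: a_def)
    define t where "t = 2 * of_nat K + cantor_point a"
    have tb: "0 \<le> cantor_point a" "cantor_point a \<le> 1" using cantor_point_bounds[of a] a1 by auto
    have cx: "c i t = x i" if "i < N" for i
    proof -
      have "c i t = (\<Sum>k. real (A i k) * (1/2) ^ Suc k)"
        unfolding c_def t_def using that by (simp add: schoenberg_clip_digit[OF a1] a_def)
      then show ?thesis using A(2)[OF that] by (simp add: sums_iff)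
    qed
    have "g t = (\<Sum>i<N. (z \<bullet> e i) *\<^sub>R e i)"
    proof -
      have "plateau t * (2 * c i t - 1) = z \<bullet> e i" if "i < N" for i
      proof -
        have "real K * (2 * x i - 1) = z \<bullet> e i" using K(3) by (simp add: x_def field_simps)
        then show ?thesis using plateau_eq[OF tb, of K, folded t_def] cx[OF that] by simp
      qed
      then show ?thesis unfolding g_def by (intro sum.cong refl) auto
    qed
    also have "\<dots> = (\<Sum>b\<in>Basis. (z \<bullet> b) *\<^sub>R b)"
      using sum.reindex_bij_betw[OF e, of "\<lambda>b. (z \<bullet> b) *\<^sub>R b"] by (simp add: atLeast0LessThan)
    also have "\<dots> = z" by (rule euclidean_representation)
    finally have "g t = z" .
    moreover have "0 \<le> t" "t \<le> 2 * norm z + 5" using tb K by (auto simp: t_def)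
    ultimately show ?thesis by blast
  qed
  ultimately show thesis by (rule that)
qed

text \<open>The least nonnegative preimage is attained because fibres are closed. Its sublevel sets
  are the images of the intervals \<open>{0..a}\<close>, which are compact; this gives measurability
  although the section need not be continuous.\<close>

lemma borel_section:
  fixes g :: "real \<Rightarrow> 'b::euclidean_space"
  assumes g: "continuous_on UNIV g"
      and ex: "\<And>z. \<exists>t. 0 \<le> t \<and> t \<le> 2 * norm z + 5 \<and> g t = z"
  obtains s where "s \<in> borel_measurable borel" "\<And>z. g (s z) = z" "\<And>z. 0 \<le> s z" "\<And>z. s z \<le> 2 * norm z + 5"
proof -
  define s where "s z = Inf ({0..} \<inter> g -` {z})" for z
  have cl: "closed ({0..} \<inter> g -` {z})" for z
    using g by (intro closed_Int closed_atLeast continuous_closed_vimage) (auto simp: continuous_on_eq_continuous_at)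
  have bb: "bdd_below ({0..} \<inter> g -` {z})" for z by (rule bdd_belowI[of _ 0]) auto
  have s_in: "s z \<in> {0..} \<inter> g -` {z}" for z
    unfolding s_def using ex[of z] by (intro closed_contains_Inf cl bb) auto
  have s_le: "s z \<le> t" if "0 \<le> t" "g t = z" for z t
    unfolding s_def using that by (intro cInf_lower bb) auto
  have "{z. s z \<le> a} = g ` {0..a}" for a
  proof (intro set_eqI iffI)
    fix z assume "z \<in> {z. s z \<le> a}" then show "z \<in> g ` {0..a}"
      using s_in[of z] by (intro image_eqI[of _ _ "s z"]) auto
  next
    fix z assume "z \<in> g ` {0..a}" then obtain t where "0 \<le> t" "t \<le> a" "g t = z" by auto
    then show "z \<in> {z. s z \<le> a}" using s_le[of t z] by auto
  qed
  then have "{z. s z \<le> a} \<in> sets borel" for a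
    using compact_continuous_image[OF continuous_on_subset[OF g], of "{0..a}"] compact_imp_closed
    by (auto intro!: borel_closed)
  then have "s \<in> borel_measurable borel"
    by (subst borel_measurable_iff_le) auto
  then show thesis
  proof (rule that[of s])
    show "s z \<le> 2 * norm z + 5" for z using ex[of z] s_le by fastforce
  qed (use s_in in auto)
qed

section \<open>Weak limits of tight sequences\<close>

text \<open>The measures are pushed to the line by the section \<open>s\<close>, and the limit found
  there is pushed back by \<open>g\<close>. Only \<open>g\<close> has to be continuous: a test
  function \<open>f\<close> is evaluated on the line as \<open>f (g t)\<close>, and
  \<open>g (s z) = z\<close> recovers its integral. The growth bound on \<open>s\<close> carries
  tightness over.\<close>

lemma tight_imp_weakly_convergent_subsequence:
  fixes \<mu> :: "nat \<Rightarrow> 'b::euclidean_space measure"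
  assumes P: "\<And>n. prob_space (\<mu> n)" and S: "\<And>n. sets (\<mu> n) = sets borel"
    and tight: "\<And>\<epsilon>. \<epsilon> > 0 \<Longrightarrow> \<exists>R. \<forall>n. measure (\<mu> n) {z. norm z > R} < \<epsilon>"
  obtains r M where "strict_mono (r :: nat \<Rightarrow> nat)" "prob_space M" "sets M = sets borel"
    "\<And>f :: 'b \<Rightarrow> real. continuous_on UNIV f \<Longrightarrow> bounded (range f) \<Longrightarrow>
        (\<lambda>n. \<integral>z. f z \<partial>\<mu> (r n)) \<longlonglongrightarrow> (\<integral>z. f z \<partial>M)"
proof -
  obtain g :: "real \<Rightarrow> 'b" where g: "continuous_on UNIV g"
    "\<And>z. \<exists>t. 0 \<le> t \<and> t \<le> 2 * norm z + 5 \<and> g t = z" using proper_space_filling_curve by blast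
  obtain s where s: "s \<in> borel_measurable borel" "\<And>z. g (s z) = z" "\<And>z. 0 \<le> s z"
     "\<And>z. s z \<le> 2 * norm z + 5" by (rule borel_section[OF g]) blast
  have gm [measurable]: "g \<in> borel_measurable borel" using g(1) by (rule borel_measurable_continuous_onI)
  have sm [measurable]: "s \<in> borel_measurable (\<mu> n)" for n
    using s(1) measurable_cong_sets[OF S refl] by blast
  define \<sigma> where "\<sigma> n = distr (\<mu> n) borel s" for n
  have rd: "real_distribution (\<sigma> n)" for n
  proof -
    interpret prob_space "\<mu> n" by (rule P)
    show ?thesis unfolding \<sigma>_def by (intro real_distribution.intro prob_space_distr)
      (auto simp: real_distribution_axioms_def)
  qed
  have "tight \<sigma>"
    unfolding tight_def
  proof (intro conjI allI impI rd)
    fix \<epsilon> :: real assume "\<epsilon> > 0"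
    then obtain R where R: "\<And>n. measure (\<mu> n) {z. norm z > R} < \<epsilon>" using tight by blast
    \<comment> \<open>Since \<open>s\<close> takes nonnegative values, the left end -1 puts 0 inside
      the half-open interval. The absolute value keeps the interval nonempty for negative
      \<open>R\<close>.\<close>
    have "1 - \<epsilon> < measure (\<sigma> n) {-1<..2 * \<bar>R\<bar> + 5}" for n
    proof -
      interpret prob_space "\<mu> n" by (rule P)
      have [measurable]: "{z. norm z > R} \<in> sets (\<mu> n)" unfolding S by measurable
      have "1 - \<epsilon> < 1 - prob {z. norm z > R}" using R[of n] by simp
      also have "\<dots> = prob (space (\<mu> n) - {z. norm z > R})"
        by (subst prob_compl) auto
      also have "\<dots> \<le> prob (s -` {-1<..2 * \<bar>R\<bar> + 5} \<inter> space (\<mu> n))"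
      proof (intro finite_measure_mono)
        show "space (\<mu> n) - {z. norm z > R} \<subseteq> s -` {-1<..2 * \<bar>R\<bar> + 5} \<inter> space (\<mu> n)"
        proof
          fix z assume "z \<in> space (\<mu> n) - {z. norm z > R}"
          then have "norm z \<le> R" "z \<in> space (\<mu> n)" by auto
          then show "z \<in> s -` {-1<..2 * \<bar>R\<bar> + 5} \<inter> space (\<mu> n)"
            using s(3,4)[of z] by auto
        qed
      qed measurable
      also have "\<dots> = measure (\<sigma> n) {-1<..2 * \<bar>R\<bar> + 5}"
        unfolding \<sigma>_def by (subst measure_distr) auto
      finally show ?thesis .
    qed
    then show "\<exists>a b. a < b \<and> (\<forall>n. 1 - \<epsilon> < measure (\<sigma> n) {a<..b})"
      by (intro exI[of _ "-1"] exI[of _ "2 * \<bar>R\<bar> + 5"]) auto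
  qed
  from tight_imp_convergent_subsubsequence[OF this strict_mono_id]
  obtain r L where r: "strict_mono (r :: nat \<Rightarrow> nat)" and L: "real_distribution L"
    and conv: "weak_conv_m (\<sigma> \<circ> r) L" by (auto simp: comp_def)
  interpret L: real_distribution L by (rule L)
  show thesis
  proof (rule that[of r "distr L borel g"])
    show "prob_space (distr L borel g)" by (rule L.prob_space_distr) simp
    fix f :: "'b \<Rightarrow> real" assume f: "continuous_on UNIV f" "bounded (range f)"
    have fm [measurable]: "f \<in> borel_measurable borel" using f(1) by (rule borel_measurable_continuous_onI)
    obtain B where B: "\<And>x. norm (f x) \<le> B" using f(2) by (auto simp: bounded_iff)
    have cg: "continuous_on UNIV (\<lambda>t. f (g t))"
      by (rule continuous_on_compose2[OF f(1) g(1)]) auto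
    have "(\<lambda>n. integral\<^sup>L ((\<sigma> \<circ> r) n) (\<lambda>t. f (g t))) \<longlonglongrightarrow> integral\<^sup>L L (\<lambda>t. f (g t))"
      using cg B rd by (intro weak_conv_imp_integral_bdd_continuous_conv[OF _ L conv])
        (auto simp: continuous_on_eq_continuous_at)
    moreover have "integral\<^sup>L ((\<sigma> \<circ> r) n) (\<lambda>t. f (g t)) = (\<integral>z. f z \<partial>\<mu> (r n))" for n
      unfolding \<sigma>_def comp_def by (subst integral_distr) (auto simp: s)
    ultimately show "(\<lambda>n. \<integral>z. f z \<partial>\<mu> (r n)) \<longlonglongrightarrow> (\<integral>z. f z \<partial>distr L borel g)"
      by (simp add: integral_distr)
  qed (use r in auto)
qed

text \<open>Indicators of closed sets are decreasing limits of bounded Lipschitz functions.\<close>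

lemma borel_measure_eqI_Lipschitz:
  fixes \<mu> \<nu> :: "'b::euclidean_space measure"
  assumes P: "prob_space \<mu>" "prob_space \<nu>" and S: "sets \<mu> = sets borel" "sets \<nu> = sets borel"
    and eq: "\<And>f L. (\<And>x. 0 \<le> f x \<and> f x \<le> (1::real)) \<Longrightarrow> (\<And>x y. \<bar>f x - f y\<bar> \<le> L * norm (x - y)) \<Longrightarrow>
       (\<integral>x. f x \<partial>\<mu>) = (\<integral>x. f x \<partial>\<nu>)"
  shows "\<mu> = \<nu>"
proof (rule measure_eqI_generator_eq[where \<Omega>=UNIV and E="{C. closed C}" and A="\<lambda>_. UNIV"])
  interpret m: prob_space \<mu> by (rule P)
  interpret n: prob_space \<nu> by (rule P)
  show "Int_stable {C :: 'b set. closed C}" by (auto simp: Int_stable_def)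
  show "sets \<mu> = sigma_sets UNIV {C. closed C}" "sets \<nu> = sigma_sets UNIV {C. closed C}"
    unfolding S by (subst borel_eq_closed, simp)+
  show "emeasure \<mu> UNIV \<noteq> \<infinity>" by simp
  fix C :: "'b set" assume "C \<in> {C. closed C}"
  then have C: "closed C" by simp
  show "emeasure \<mu> C = emeasure \<nu> C"
  \<comment> \<open>\<open>infdist\<close> to the empty set is 0 by convention, so the approximating
    functions would then converge to 1 instead of the indicator.\<close>
  proof (cases "C = {}")
    case False
    define f where "f k x = max 0 (1 - real k * infdist x C)" for k :: nat and x
    have fb: "0 \<le> f k x" "f k x \<le> 1" for k x by (auto simp: f_def infdist_nonneg)
    have fL: "\<bar>f k x - f k y\<bar> \<le> real k * norm (x - y)" for k x y
    proof -
      have "\<bar>infdist x C - infdist y C\<bar> \<le> dist x y" by (rule infdist_triangle_abs)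
      then have "real k * \<bar>infdist x C - infdist y C\<bar> \<le> real k * norm (x - y)"
        by (intro mult_left_mono) (auto simp: dist_norm)
      moreover have "\<bar>f k x - f k y\<bar> \<le> \<bar>real k * infdist x C - real k * infdist y C\<bar>"
        unfolding f_def by linarith
      moreover have "\<bar>real k * infdist x C - real k * infdist y C\<bar> = real k * \<bar>infdist x C - infdist y C\<bar>"
        by (simp add: abs_mult flip: right_diff_distrib)
      ultimately show ?thesis by linarith
    qed
    have fm [measurable]: "f k \<in> borel_measurable borel" for k
      unfolding f_def by (intro borel_measurable_continuous_onI continuous_intros)
    have lim: "(\<lambda>k. f k x) \<longlonglongrightarrow> indicat_real C x" for x
    proof (cases "x \<in> C")
      case True then show ?thesis by (simp add: f_def)
    next
      case nC: False
      then have pos: "infdist x C > 0" using C False infdist_pos_not_in_closed by blast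
      obtain K :: nat where K: "1 < real K * infdist x C" using pos ex_less_of_nat_mult by blast
      have "f k x = 0" if "k \<ge> K" for k
      proof -
        have "real K * infdist x C \<le> real k * infdist x C" using that pos by simp
        then show ?thesis using K by (simp add: f_def)
      qed
      then have "\<forall>\<^sub>F k in sequentially. f k x = 0" by (auto simp: eventually_sequentially)
      then show ?thesis using nC by (simp add: tendsto_eventually)
    qed
    have L: "(\<lambda>k. \<integral>x. f k x \<partial>M) \<longlonglongrightarrow> measure M C" if "prob_space M" "sets M = sets borel" for M
    proof -
      interpret prob_space M by fact
      have [measurable_cong]: "sets M = sets borel" by fact
      have [measurable]: "C \<in> sets M" unfolding that by (rule borel_closed[OF C])
      have sp: "space M = UNIV" using sets_eq_imp_space_eq[OF that(2)] by simp
      have "(\<lambda>k. \<integral>x. f k x \<partial>M) \<longlonglongrightarrow> (\<integral>x. indicat_real C x \<partial>M)"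
        using fb lim by (intro integral_dominated_convergence[where w="\<lambda>_. 1"]) auto
      then show ?thesis by (simp add: sp)
    qed
    have "(\<lambda>k. \<integral>x. f k x \<partial>\<mu>) = (\<lambda>k. \<integral>x. f k x \<partial>\<nu>)"
      using fb fL by (intro ext eq) auto
    then have "measure \<mu> C = measure \<nu> C"
      using L[OF P(1) S(1)] L[OF P(2) S(2)] LIMSEQ_unique by metis
    then show ?thesis by (simp add: m.emeasure_eq_measure n.emeasure_eq_measure)
  qed simp
qed auto

section \<open>Optimal couplings\<close>

lemma measurable_fst_borel [measurable]: "fst \<in> borel_measurable (borel :: ('a::euclidean_space \<times> 'b::euclidean_space) measure)"
  and measurable_snd_borel [measurable]: "snd \<in> borel_measurable (borel :: ('a::euclidean_space \<times> 'b::euclidean_space) measure)"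
  by (intro borel_measurable_continuous_onI continuous_intros)+

lemma PpD:
  assumes "\<mu> \<in> Pp p"
  shows "prob_space \<mu>" "sets \<mu> = sets borel" "(\<integral>\<^sup>+ x. ennreal (norm x powr p) \<partial>\<mu>) < \<infinity>"
  using assms by (auto simp: Pp_def)

lemma couplingsD:
  assumes "\<pi> \<in> couplings \<mu> \<nu>"
  shows "prob_space \<pi>" "sets \<pi> = sets borel" "distr \<pi> borel fst = \<mu>" "distr \<pi> borel snd = \<nu>"
  using assms by (auto simp: couplings_def)

lemma product_coupling:
  fixes \<mu> \<nu> :: "'a::euclidean_space measure"
  assumes "prob_space \<mu>" "prob_space \<nu>" "sets \<mu> = sets borel" "sets \<nu> = sets borel"
  shows "\<mu> \<Otimes>\<^sub>M \<nu> \<in> couplings \<mu> \<nu>"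
proof -
  interpret m: prob_space \<mu> by fact
  interpret n: prob_space \<nu> by fact
  interpret pair_prob_space \<mu> \<nu> ..
  have "distr (\<mu> \<Otimes>\<^sub>M \<nu>) borel fst = distr (\<mu> \<Otimes>\<^sub>M \<nu>) \<mu> fst"
    by (rule distr_cong) (auto simp: assms)
  moreover have "distr (\<mu> \<Otimes>\<^sub>M \<nu>) borel snd = \<nu>"
  proof (rule measure_eqI)
    fix A assume "A \<in> sets (distr (\<mu> \<Otimes>\<^sub>M \<nu>) borel snd)"
    then have A: "A \<in> sets \<nu>" by (simp add: assms)
    have "snd \<in> \<mu> \<Otimes>\<^sub>M \<nu> \<rightarrow>\<^sub>M borel" using assms(4) measurable_snd measurable_cong_sets by blast
    then have "emeasure (distr (\<mu> \<Otimes>\<^sub>M \<nu>) borel snd) A = emeasure (\<mu> \<Otimes>\<^sub>M \<nu>) (snd -` A \<inter> space (\<mu> \<Otimes>\<^sub>M \<nu>))"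
      using A assms by (subst emeasure_distr) auto
    also have "snd -` A \<inter> space (\<mu> \<Otimes>\<^sub>M \<nu>) = space \<mu> \<times> A"
      using sets.sets_into_space[OF A] by (auto simp: space_pair_measure)
    also have "emeasure (\<mu> \<Otimes>\<^sub>M \<nu>) \<dots> = emeasure \<nu> A"
      using A by (subst n.emeasure_pair_measure_Times) (auto simp: m.emeasure_space_1)
    finally show "emeasure (distr (\<mu> \<Otimes>\<^sub>M \<nu>) borel snd) A = emeasure \<nu> A" .
  qed (simp add: assms)
  moreover have "sets (\<mu> \<Otimes>\<^sub>M \<nu>) = sets borel"
    using sets_pair_measure_cong[OF assms(3,4)] unfolding borel_prod .
  ultimately show ?thesis
    using n.distr_pair_fst[of \<mu>] prob_space_axioms by (simp add: couplings_def)
qed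

lemma coupling_distr:
  fixes \<pi> :: "('a::euclidean_space \<times> 'a) measure" and f :: "'a \<Rightarrow> 'b::euclidean_space"
  assumes "\<pi> \<in> couplings \<mu> \<nu>" and [measurable]: "f \<in> borel_measurable borel"
  shows "(\<integral>z. f (fst z) \<partial>\<pi>) = (\<integral>x. f x \<partial>\<mu>)" "(\<integral>z. f (snd z) \<partial>\<pi>) = (\<integral>y. f y \<partial>\<nu>)"
proof -
  note c = couplingsD[OF assms(1)]
  have [measurable_cong]: "sets \<pi> = sets borel" by (rule c)
  have "fst \<in> borel_measurable \<pi>" "snd \<in> borel_measurable \<pi>" by measurable
  then show "(\<integral>z. f (fst z) \<partial>\<pi>) = (\<integral>x. f x \<partial>\<mu>)" "(\<integral>z. f (snd z) \<partial>\<pi>) = (\<integral>y. f y \<partial>\<nu>)"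
    unfolding c(3,4)[symmetric] by (simp_all add: integral_distr)
qed

lemma coupling_nn_distr:
  fixes \<pi> :: "('a::euclidean_space \<times> 'a) measure" and f :: "'a \<Rightarrow> ennreal"
  assumes "\<pi> \<in> couplings \<mu> \<nu>" and [measurable]: "f \<in> borel_measurable borel"
  shows "(\<integral>\<^sup>+z. f (fst z) \<partial>\<pi>) = (\<integral>\<^sup>+x. f x \<partial>\<mu>)" "(\<integral>\<^sup>+z. f (snd z) \<partial>\<pi>) = (\<integral>\<^sup>+y. f y \<partial>\<nu>)"
proof -
  note c = couplingsD[OF assms(1)]
  have [measurable_cong]: "sets \<pi> = sets borel" by (rule c)
  have "fst \<in> borel_measurable \<pi>" "snd \<in> borel_measurable \<pi>" by measurable
  then show "(\<integral>\<^sup>+z. f (fst z) \<partial>\<pi>) = (\<integral>\<^sup>+x. f x \<partial>\<mu>)" "(\<integral>\<^sup>+z. f (snd z) \<partial>\<pi>) = (\<integral>\<^sup>+y. f y \<partial>\<nu>)"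
    unfolding c(3,4)[symmetric] by (simp_all add: nn_integral_distr)
qed

lemma norm_diff_powr_le:
  fixes x y :: "'a::real_normed_vector"
  assumes "p > 0"
  shows "norm (x - y) powr p \<le> 2 powr p * (norm x powr p + norm y powr p)"
proof -
  have "norm (x - y) \<le> 2 * max (norm x) (norm y)" using norm_triangle_ineq4[of x y] by linarith
  then have "norm (x - y) powr p \<le> (2 * max (norm x) (norm y)) powr p"
    using assms by (intro powr_mono2) auto
  also have "\<dots> = 2 powr p * (max (norm x) (norm y)) powr p" by (simp add: powr_mult)
  also have "\<dots> \<le> 2 powr p * (norm x powr p + norm y powr p)"
    by (intro mult_left_mono) (auto simp: max_def)
  finally show ?thesis .
qed

section \<open>The direct method for the transport cost\<close>

lemma transport_cost_finite:
  fixes \<mu> \<nu> :: "'a::euclidean_space measure"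
  assumes p: "p > 0" and "\<mu> \<in> Pp p" "\<nu> \<in> Pp p" and c: "\<pi> \<in> couplings \<mu> \<nu>"
  shows "transport_cost p \<pi> < \<infinity>"
proof -
  have [measurable_cong]: "sets \<pi> = sets borel" by (rule couplingsD[OF c])
  have "transport_cost p \<pi> \<le> (\<integral>\<^sup>+ z. ennreal (2 powr p) * (ennreal (norm (fst z) powr p) + ennreal (norm (snd z) powr p)) \<partial>\<pi>)"
    unfolding transport_cost_def
    by (intro nn_integral_mono)
      (simp add: norm_diff_powr_le[OF p] flip: ennreal_plus ennreal_mult)
  also have "\<dots> = ennreal (2 powr p) * ((\<integral>\<^sup>+ z. ennreal (norm (fst z) powr p) \<partial>\<pi>) + (\<integral>\<^sup>+ z. ennreal (norm (snd z) powr p) \<partial>\<pi>))"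
    by (subst nn_integral_cmult, measurable) (subst nn_integral_add, auto)
  also have "\<dots> = ennreal (2 powr p) * ((\<integral>\<^sup>+ x. ennreal (norm x powr p) \<partial>\<mu>) + (\<integral>\<^sup>+ y. ennreal (norm y powr p) \<partial>\<nu>))"
    by (subst coupling_nn_distr(1)[OF c], measurable) (subst coupling_nn_distr(2)[OF c], auto)
  also have "\<dots> < \<infinity>" using PpD(3)[OF assms(2)] PpD(3)[OF assms(3)]
    by (auto simp: ennreal_mult_less_top)
  finally show ?thesis .
qed

lemma prob_norm_tail:
  fixes \<mu> :: "'a::euclidean_space measure"
  assumes "prob_space \<mu>" "sets \<mu> = sets borel" "\<epsilon> > 0"
  obtains R where "measure \<mu> {x. norm x > R} < \<epsilon>"
proof -
  interpret prob_space \<mu> by fact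
  have [measurable_cong]: "sets \<mu> = sets borel" by fact
  have "(\<lambda>n. measure \<mu> {x. norm x > real n}) \<longlonglongrightarrow> measure \<mu> (\<Inter>n. {x. norm x > real n})"
  proof (rule finite_Lim_measure_decseq)
    show "range (\<lambda>n. {x. norm x > real n}) \<subseteq> sets \<mu>" unfolding assms(2) by auto
    show "decseq (\<lambda>n. {x :: 'a. norm x > real n})" by (auto simp: decseq_def)
  qed
  also have "(\<Inter>n. {x :: 'a. norm x > real n}) = {}"
    using real_arch_simple[of "norm _"] by (auto simp flip: not_le)
  finally have "\<forall>\<^sub>F n in sequentially. measure \<mu> {x. norm x > real n} < \<epsilon>"
    using assms(3) by (intro order_tendstoD) auto
  then obtain n :: nat where "measure \<mu> {x. norm x > real n} < \<epsilon>"
    by (auto simp: eventually_sequentially)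
  then show thesis by (rule that)
qed

lemma couplings_tight:
  fixes \<mu> \<nu> :: "'a::euclidean_space measure"
  assumes "prob_space \<mu>" "prob_space \<nu>" "sets \<mu> = sets borel" "sets \<nu> = sets borel" and "\<epsilon> > 0"
  shows "\<exists>R. \<forall>\<pi>\<in>couplings \<mu> \<nu>. measure \<pi> {z. norm z > R} < \<epsilon>"
proof -
  obtain A where A: "measure \<mu> {x. norm x > A} < \<epsilon> / 2" using prob_norm_tail[OF assms(1,3)] assms(5) by (meson half_gt_zero)
  obtain B where B: "measure \<nu> {x. norm x > B} < \<epsilon> / 2" using prob_norm_tail[OF assms(2,4)] assms(5) by (meson half_gt_zero)
  have "measure \<pi> {z. norm z > A + B} < \<epsilon>" if c: "\<pi> \<in> couplings \<mu> \<nu>" for \<pi>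
  proof -
    note cD = couplingsD[OF c]
    interpret prob_space \<pi> by (rule cD)
    have [measurable_cong]: "sets \<pi> = sets borel" by (rule cD)
    have sp: "space \<pi> = UNIV" using sets_eq_imp_space_eq[OF cD(2)] by simp
    have "z \<in> {z. norm (fst z) > A} \<union> {z. norm (snd z) > B}" if "norm z > A + B" for z :: "'a \<times> 'a"
      using norm_Pair_le[of "fst z" "snd z"] that by auto
    then have "measure \<pi> {z. norm z > A + B} \<le> measure \<pi> ({z. norm (fst z) > A} \<union> {z. norm (snd z) > B})"
      by (intro finite_measure_mono) (auto simp: cD)
    also have "\<dots> \<le> measure \<pi> {z. norm (fst z) > A} + measure \<pi> {z. norm (snd z) > B}"
      by (rule measure_Un_le) (simp add: cD, measurable)+
    also have "measure \<pi> {z. norm (fst z) > A} = measure \<mu> {x. norm x > A}"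
      unfolding cD(3)[symmetric] by (subst measure_distr) (auto simp: sp vimage_def)
    also have "measure \<pi> {z. norm (snd z) > B} = measure \<nu> {x. norm x > B}"
      unfolding cD(4)[symmetric] by (subst measure_distr) (auto simp: sp vimage_def)
    finally show ?thesis using A B by linarith
  qed
  then show ?thesis by blast
qed

text \<open>The cost is continuous but unbounded, so weak convergence is applied to its truncations
  at \<open>k\<close>. Each of them has limit at most \<open>c\<close>, and monotone convergence
  removes the truncation.\<close>

lemma transport_cost_le_weak_limit:
  fixes \<pi>s :: "nat \<Rightarrow> ('a::euclidean_space \<times> 'a) measure"
  assumes p: "p > 0" and P: "\<And>n. prob_space (\<pi>s n)" "prob_space \<pi>"
    and S: "\<And>n. sets (\<pi>s n) = sets borel" "sets \<pi> = sets borel"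
    and lim: "\<And>f :: 'a \<times> 'a \<Rightarrow> real. continuous_on UNIV f \<Longrightarrow> bounded (range f) \<Longrightarrow>
        (\<lambda>n. \<integral>z. f z \<partial>\<pi>s n) \<longlonglongrightarrow> (\<integral>z. f z \<partial>\<pi>)"
    and c: "(\<lambda>n. transport_cost p (\<pi>s n)) \<longlonglongrightarrow> c"
  shows "transport_cost p \<pi> \<le> c"
proof -
  have [measurable_cong]: "sets \<pi> = sets borel" by (rule S)
  define f where "f k z = min (real k) (norm (fst z - snd z) powr p)" for k :: nat and z :: "'a \<times> 'a"
  have fc: "continuous_on UNIV (f k)" for k
    unfolding f_def using p by (intro continuous_intros continuous_on_powr') auto
  have fm [measurable]: "f k \<in> borel_measurable borel" for k
    using fc by (rule borel_measurable_continuous_onI)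
  have fb: "0 \<le> f k z" "f k z \<le> real k" for k z by (auto simp: f_def)
  have bdd: "bounded (range (f k))" for k
    using fb by (auto simp: bounded_iff intro!: exI[of _ "real k"])
  have le: "(\<integral>\<^sup>+z. ennreal (f k z) \<partial>\<pi>) \<le> c" for k
  proof (rule tendsto_le[OF _ c])
    have nn: "(\<integral>\<^sup>+z. ennreal (f k z) \<partial>M) = ennreal (\<integral>z. f k z \<partial>M)" if "prob_space M" "sets M = sets borel" for M
    proof -
      interpret prob_space M by fact
      have [measurable_cong]: "sets M = sets borel" by fact
      show ?thesis using fb
        by (intro nn_integral_eq_integral integrable_const_bound[of _ "real k"]) auto
    qed
    show "(\<lambda>n. \<integral>\<^sup>+z. ennreal (f k z) \<partial>\<pi>s n) \<longlonglongrightarrow> (\<integral>\<^sup>+z. ennreal (f k z) \<partial>\<pi>)"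
      unfolding nn[OF P(1) S(1)] nn[OF P(2) S(2)] by (intro tendsto_ennrealI lim fc bdd)
    show "\<forall>\<^sub>F n in sequentially. (\<integral>\<^sup>+z. ennreal (f k z) \<partial>\<pi>s n) \<le> transport_cost p (\<pi>s n)"
      unfolding transport_cost_def f_def
      by (intro always_eventually allI nn_integral_mono ennreal_leI) auto
  qed simp
  have "transport_cost p \<pi> = (\<integral>\<^sup>+z. (SUP k. ennreal (f k z)) \<partial>\<pi>)"
    unfolding transport_cost_def
  proof (intro nn_integral_cong antisym)
    fix z :: "'a \<times> 'a"
    obtain k where "norm (fst z - snd z) powr p \<le> real k" using real_arch_simple by blast
    then have "ennreal (norm (fst z - snd z) powr p) = ennreal (f k z)" by (simp add: f_def)
    then show "ennreal (norm (fst z - snd z) powr p) \<le> (SUP k. ennreal (f k z))"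
      by (auto intro: SUP_upper)
    show "(SUP k. ennreal (f k z)) \<le> ennreal (norm (fst z - snd z) powr p)"
      by (intro SUP_least ennreal_leI) (simp add: f_def)
  qed
  also have "\<dots> = (SUP k. \<integral>\<^sup>+z. ennreal (f k z) \<partial>\<pi>)"
    by (intro nn_integral_monotone_convergence_SUP)
      (auto simp: incseq_def le_fun_def f_def intro!: ennreal_leI)
  also have "\<dots> \<le> c" using le by (intro SUP_least)
  finally show ?thesis .
qed

text \<open>A test function of one coordinate is a bounded continuous function on the product, and
  its integral is constant along the sequence because the marginals are. Test functions of one
  coordinate determine the marginal of the limit.\<close>

lemma couplings_closed:
  fixes \<pi>s :: "nat \<Rightarrow> ('a::euclidean_space \<times> 'a) measure"
  assumes c: "\<And>n. \<pi>s n \<in> couplings \<mu> \<nu>" and P: "prob_space \<pi>" "sets \<pi> = sets borel"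
    and lim: "\<And>f :: 'a \<times> 'a \<Rightarrow> real. continuous_on UNIV f \<Longrightarrow> bounded (range f) \<Longrightarrow>
        (\<lambda>n. \<integral>z. f z \<partial>\<pi>s n) \<longlonglongrightarrow> (\<integral>z. f z \<partial>\<pi>)"
  shows "\<pi> \<in> couplings \<mu> \<nu>"
proof -
  interpret prob_space \<pi> by fact
  have [measurable_cong]: "sets \<pi> = sets borel" by fact
  have marg: "distr \<pi> borel h = M" if h: "continuous_on UNIV h" and Mn: "\<And>n. distr (\<pi>s n) borel h = M"
    for h :: "'a \<times> 'a \<Rightarrow> 'a" and M
  proof (rule borel_measure_eqI_Lipschitz)
    have hm [measurable]: "h \<in> borel_measurable borel" using h by (rule borel_measurable_continuous_onI)
    have hn: "h \<in> borel_measurable (\<pi>s n)" for n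
      using hm measurable_cong_sets[OF couplingsD(2)[OF c] refl] by blast
    show "prob_space (distr \<pi> borel h)" by (rule prob_space_distr) simp
    show "prob_space M" unfolding Mn[of 0, symmetric]
      by (rule prob_space.prob_space_distr[OF couplingsD(1)[OF c] hn])
    show "sets M = sets borel" unfolding Mn[of 0, symmetric] by simp
    fix f :: "'a \<Rightarrow> real" and L
    assume f: "\<And>x. 0 \<le> f x \<and> f x \<le> 1" "\<And>x y. \<bar>f x - f y\<bar> \<le> L * norm (x - y)"
    have fc: "continuous_on UNIV f"
    proof (rule lipschitz_on_continuous_on)
      show "\<bar>L\<bar>-lipschitz_on UNIV f"
      proof (rule lipschitz_onI)
        fix x y :: 'a
        have "L * norm (x - y) \<le> \<bar>L\<bar> * norm (x - y)" by (intro mult_right_mono) auto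
        then show "dist (f x) (f y) \<le> \<bar>L\<bar> * dist x y"
          using f(2)[of x y] by (simp add: dist_norm)
      qed simp
    qed
    have [measurable]: "f \<in> borel_measurable borel" using fc by (rule borel_measurable_continuous_onI)
    have "(\<lambda>n. \<integral>z. f (h z) \<partial>\<pi>s n) \<longlonglongrightarrow> (\<integral>z. f (h z) \<partial>\<pi>)"
    proof (rule lim)
      show "continuous_on UNIV (\<lambda>z. f (h z))" by (rule continuous_on_compose2[OF fc h]) auto
      show "bounded (range (\<lambda>z. f (h z)))" using f(1) by (auto simp: bounded_iff intro!: exI[of _ 1])
    qed
    moreover have "(\<integral>z. f (h z) \<partial>\<pi>s n) = (\<integral>x. f x \<partial>M)" for n
      unfolding Mn[of n, symmetric] using hn by (simp add: integral_distr)
    ultimately have "(\<integral>z. f (h z) \<partial>\<pi>) = (\<integral>x. f x \<partial>M)" by (simp add: LIMSEQ_const_iff)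
    then show "(\<integral>x. f x \<partial>distr \<pi> borel h) = (\<integral>x. f x \<partial>M)" by (simp add: integral_distr)
  qed simp
  have "distr \<pi> borel fst = \<mu>"
    by (rule marg[OF continuous_on_fst[OF continuous_on_id] couplingsD(3)[OF c]])
  moreover have "distr \<pi> borel snd = \<nu>"
    by (rule marg[OF continuous_on_snd[OF continuous_on_id] couplingsD(4)[OF c]])
  ultimately show ?thesis using P by (simp add: couplings_def)
qed

text \<open>A minimizing sequence is tight because its marginals are fixed; a weak limit is a
  coupling again and does not cost more than the infimum.\<close>

lemma optimal_coupling_exists:
  fixes \<mu> \<nu> :: "'a::euclidean_space measure"
  assumes p: "p > 0" and m: "\<mu> \<in> Pp p" and n: "\<nu> \<in> Pp p"
  obtains \<pi> where "\<pi> \<in> optimal_couplings p \<mu> \<nu>" "transport_cost p \<pi> = ennreal (Wp p \<mu> \<nu> powr p)"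
proof -
  note mD = PpD[OF m] and nD = PpD[OF n]
  define I where "I = (INF \<pi>\<in>couplings \<mu> \<nu>. transport_cost p \<pi>)"
  have ne: "couplings \<mu> \<nu> \<noteq> {}" using product_coupling[OF mD(1) nD(1) mD(2) nD(2)] by blast
  have "transport_cost p ` couplings \<mu> \<nu> \<noteq> {}" using ne by simp
  from ennreal_Inf_countable_INF[OF this] obtain u :: "nat \<Rightarrow> ennreal"
    where u: "decseq u" "range u \<subseteq> transport_cost p ` couplings \<mu> \<nu>" "I = (INF i. u i)"
    unfolding I_def by auto
  have "\<forall>n. \<exists>\<pi>\<in>couplings \<mu> \<nu>. u n = transport_cost p \<pi>" using u(2) by blast
  then obtain \<pi>s where ps: "\<And>n. \<pi>s n \<in> couplings \<mu> \<nu>" "\<And>n. u n = transport_cost p (\<pi>s n)" by metis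
  have lim: "(\<lambda>n. transport_cost p (\<pi>s n)) \<longlonglongrightarrow> I"
    using LIMSEQ_INF[OF u(1)] unfolding u(3) ps(2) .
  obtain r \<pi> where r: "strict_mono (r :: nat \<Rightarrow> nat)" and pi: "prob_space \<pi>" "sets \<pi> = sets borel"
    and conv: "\<And>f :: 'a \<times> 'a \<Rightarrow> real. continuous_on UNIV f \<Longrightarrow> bounded (range f) \<Longrightarrow>
        (\<lambda>n. \<integral>z. f z \<partial>\<pi>s (r n)) \<longlonglongrightarrow> (\<integral>z. f z \<partial>\<pi>)"
  proof (rule tight_imp_weakly_convergent_subsequence[of \<pi>s])
    fix \<epsilon> :: real assume "\<epsilon> > 0"
    then show "\<exists>R. \<forall>n. measure (\<pi>s n) {z. norm z > R} < \<epsilon>"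
      using couplings_tight[OF mD(1) nD(1) mD(2) nD(2)] ps(1) by meson
  qed (use couplingsD[OF ps(1)] in auto)
  have c: "\<pi> \<in> couplings \<mu> \<nu>"
    by (rule couplings_closed[of "\<lambda>n. \<pi>s (r n)"]) (use ps pi conv in auto)
  have "transport_cost p \<pi> \<le> I"
    using couplingsD(1,2)[OF ps(1)] pi conv LIMSEQ_subseq_LIMSEQ[OF lim r]
    by (intro transport_cost_le_weak_limit[of p "\<lambda>n. \<pi>s (r n)"] p) (auto simp: comp_def)
  moreover have "I \<le> transport_cost p \<pi>" unfolding I_def using c by (rule INF_lower)
  ultimately have eq: "transport_cost p \<pi> = I" by (rule antisym)
  \<comment> \<open>Finiteness matters since \<open>Wp\<close> passes through
    \<open>enn2real\<close>, which would send an infinite cost to 0.\<close>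
  have "I < \<infinity>" using transport_cost_finite[OF p m n c] eq by simp
  then have "I = ennreal (Wp p \<mu> \<nu> powr p)"
    unfolding Wp_def I_def[symmetric] using p by (simp add: powr_powr)
  then show thesis using that[of \<pi>] c eq by (simp add: optimal_couplings_def I_def)
qed

section \<open>The quadratic form of second moments\<close>

definition moment :: "'a::euclidean_space measure \<Rightarrow> 'a \<Rightarrow> 'a \<Rightarrow> real" where
  "moment \<mu> b c = (\<integral>x. (x \<bullet> b) * (x \<bullet> c) \<partial>\<mu>)"

text \<open>Matrices are functions on pairs of basis vectors. The form is the Frobenius product of
  the trace-free parts, so that TP is the squared norm of the trace-free part of the second moment
  matrix.\<close>

definition tp_form :: "('a::euclidean_space \<Rightarrow> 'a \<Rightarrow> real) \<Rightarrow> ('a \<Rightarrow> 'a \<Rightarrow> real) \<Rightarrow> real" where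
  "tp_form m n = (\<Sum>b\<in>Basis. \<Sum>c\<in>Basis. m b c * n b c)
     - (\<Sum>b\<in>Basis. m b b) * (\<Sum>b\<in>Basis. n b b) / real DIM('a)"

definition entry_sum :: "('a::euclidean_space \<Rightarrow> 'a \<Rightarrow> real) \<Rightarrow> real" where
  "entry_sum m = (\<Sum>b\<in>Basis. \<Sum>c\<in>Basis. \<bar>m b c\<bar>)"

text \<open>The Riesz vector of the first-order change of \<open>tp_form m m\<close> when mass at
  \<open>x\<close> is displaced. For symmetric \<open>m\<close> it is
  \<open>4 * (m - (tr m / d) * Id)\<close> applied to \<open>x\<close>.\<close>

definition tp_grad :: "('a::euclidean_space \<Rightarrow> 'a \<Rightarrow> real) \<Rightarrow> 'a \<Rightarrow> 'a" where
  "tp_grad m x = (\<Sum>e\<in>Basis. (2 * tp_form m (\<lambda>b c. (x \<bullet> b) * (e \<bullet> c) + (e \<bullet> b) * (x \<bullet> c))) *\<^sub>R e)"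

lemma tp_form_add: "tp_form m (\<lambda>b c. u b c + v b c) = tp_form m u + tp_form m v"
  by (simp add: tp_form_def sum.distrib distrib_left add_divide_distrib)

lemma tp_form_scale: "tp_form m (\<lambda>b c. k * u b c) = k * tp_form m u"
  by (simp add: tp_form_def mult.left_commute[of _ k] right_diff_distrib mult.assoc flip: sum_distrib_left)

lemma tp_form_commute: "tp_form m n = tp_form n m"
  by (simp add: tp_form_def mult.commute)

lemma tp_form_sum: "tp_form m (\<lambda>b c. \<Sum>i\<in>I. u i b c) = (\<Sum>i\<in>I. tp_form m (u i))"
proof (induction I rule: infinite_finite_induct)
  case (insert i I) then show ?case by (simp add: tp_form_add)
qed (simp_all add: tp_form_def)

lemma tp_form_integral:
  assumes "\<And>b c. b \<in> Basis \<Longrightarrow> c \<in> Basis \<Longrightarrow> integrable M (\<lambda>w. u w b c)"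
  shows "(\<integral>w. tp_form m (u w) \<partial>M) = tp_form m (\<lambda>b c. \<integral>w. u w b c \<partial>M)"
  using assms by (simp add: tp_form_def)

lemma entry_sum_nonneg: "0 \<le> entry_sum m"
  by (simp add: entry_sum_def sum_nonneg)

lemma entry_sum_le:
  fixes m :: "'a::euclidean_space \<Rightarrow> 'a \<Rightarrow> real"
  assumes "\<And>b c. b \<in> Basis \<Longrightarrow> c \<in> Basis \<Longrightarrow> \<bar>m b c\<bar> \<le> B"
  shows "entry_sum m \<le> (real DIM('a))\<^sup>2 * B"
proof -
  have "entry_sum m \<le> (\<Sum>b\<in>(Basis :: 'a set). \<Sum>c\<in>(Basis :: 'a set). B)"
    unfolding entry_sum_def using assms by (intro sum_mono)
  then show ?thesis by (simp add: power2_eq_square)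
qed

lemma abs_entry_le:
  fixes m :: "'a::euclidean_space \<Rightarrow> 'a \<Rightarrow> real"
  assumes "b \<in> Basis" "c \<in> Basis" shows "\<bar>m b c\<bar> \<le> entry_sum m"
proof -
  have "\<bar>m b c\<bar> \<le> (\<Sum>c\<in>Basis. \<bar>m b c\<bar>)" using assms(2) by (intro member_le_sum) auto
  also have "\<dots> \<le> entry_sum m" unfolding entry_sum_def
    using assms(1) by (intro member_le_sum[of b Basis "\<lambda>b. \<Sum>c\<in>Basis. \<bar>m b c\<bar>"]) (auto simp: sum_nonneg)
  finally show ?thesis .
qed

lemma abs_trace_le: 
  fixes m :: "'a::euclidean_space \<Rightarrow> 'a \<Rightarrow> real"
  shows "\<bar>\<Sum>b\<in>Basis. m b b\<bar> \<le> entry_sum m"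
proof -
  have "\<bar>\<Sum>b\<in>(Basis::'a set). m b b\<bar> \<le> (\<Sum>b\<in>Basis. \<bar>m b b\<bar>)" by (rule sum_abs)
  also have "\<dots> \<le> entry_sum m" unfolding entry_sum_def
    by (intro sum_mono member_le_sum) auto
  finally show ?thesis .
qed

text \<open>One copy of the product bounds the Frobenius part and one the trace part, where division
  by the dimension only helps.\<close>

lemma abs_tp_form_le:
  fixes m n :: "'a::euclidean_space \<Rightarrow> 'a \<Rightarrow> real"
  shows "\<bar>tp_form m n\<bar> \<le> 2 * (entry_sum m * entry_sum n)"
proof -
  have "\<bar>\<Sum>b\<in>Basis. \<Sum>c\<in>Basis. m b c * n b c\<bar> \<le> (\<Sum>b\<in>Basis. \<Sum>c\<in>Basis. \<bar>m b c\<bar> * entry_sum n)"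
    by (intro order_trans[OF sum_abs] sum_mono)
      (auto simp: abs_mult intro!: mult_left_mono abs_entry_le order_trans[OF sum_abs] sum_mono)
  also have "\<dots> = entry_sum m * entry_sum n" by (simp add: entry_sum_def sum_distrib_right)
  finally have 1: "\<bar>\<Sum>b\<in>Basis. \<Sum>c\<in>Basis. m b c * n b c\<bar> \<le> entry_sum m * entry_sum n" .
  have "\<bar>(\<Sum>b\<in>Basis. m b b) * (\<Sum>b\<in>Basis. n b b) / real DIM('a)\<bar>
      \<le> \<bar>(\<Sum>b\<in>Basis. m b b) * (\<Sum>b\<in>Basis. n b b)\<bar> / 1"
    unfolding abs_divide by (intro divide_left_mono) (auto simp: DIM_positive Suc_leI)
  also have "\<dots> \<le> entry_sum m * entry_sum n"
    by (auto simp: abs_mult intro!: mult_mono abs_trace_le entry_sum_nonneg)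
  finally show ?thesis using 1 unfolding tp_form_def by linarith
qed

text \<open>The field is defined by its coordinates; linearity of the form in its second argument
  and the expansion of \<open>h\<close> in the basis extend the formula to every direction.\<close>

lemma inner_tp_grad:
  "tp_grad m x \<bullet> h = 2 * tp_form m (\<lambda>b c. (x \<bullet> b) * (h \<bullet> c) + (h \<bullet> b) * (x \<bullet> c))"
proof -
  have "tp_grad m x \<bullet> h = (\<Sum>e\<in>Basis. (2 * tp_form m (\<lambda>b c. (x \<bullet> b) * (e \<bullet> c) + (e \<bullet> b) * (x \<bullet> c))) * (e \<bullet> h))"
    by (simp add: tp_grad_def inner_sum_left)
  also have "\<dots> = 2 * (\<Sum>e\<in>Basis. tp_form m (\<lambda>b c. (e \<bullet> h) * ((x \<bullet> b) * (e \<bullet> c) + (e \<bullet> b) * (x \<bullet> c))))"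
    by (simp add: tp_form_scale sum_distrib_left mult_ac)
  also have "\<dots> = 2 * tp_form m (\<lambda>b c. \<Sum>e\<in>Basis. (e \<bullet> h) * ((x \<bullet> b) * (e \<bullet> c) + (e \<bullet> b) * (x \<bullet> c)))"
    by (simp add: tp_form_sum)
  also have "(\<lambda>b c. \<Sum>e\<in>Basis. (e \<bullet> h) * ((x \<bullet> b) * (e \<bullet> c) + (e \<bullet> b) * (x \<bullet> c)))
     = (\<lambda>b c. (x \<bullet> b) * (h \<bullet> c) + (h \<bullet> b) * (x \<bullet> c))"
  proof (intro ext)
    fix b c
    have hd: "(\<Sum>e\<in>Basis. (h \<bullet> e) * (e \<bullet> d)) = h \<bullet> d" for d
      using arg_cong[OF euclidean_representation[of h], of "\<lambda>v. v \<bullet> d"] by (simp add: inner_sum_left)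
    have "(\<Sum>e\<in>Basis. (e \<bullet> h) * ((x \<bullet> b) * (e \<bullet> c) + (e \<bullet> b) * (x \<bullet> c)))
        = (x \<bullet> b) * (\<Sum>e\<in>Basis. (h \<bullet> e) * (e \<bullet> c)) + (\<Sum>e\<in>Basis. (h \<bullet> e) * (e \<bullet> b)) * (x \<bullet> c)"
      by (simp add: sum.distrib distrib_left sum_distrib_left sum_distrib_right inner_commute[of _ h] mult_ac)
    then show "(\<Sum>e\<in>Basis. (e \<bullet> h) * ((x \<bullet> b) * (e \<bullet> c) + (e \<bullet> b) * (x \<bullet> c)))
        = (x \<bullet> b) * (h \<bullet> c) + (h \<bullet> b) * (x \<bullet> c)" unfolding hd .
  qed
  finally show ?thesis .
qed

lemma abs_inner_mult_le:
  assumes "b \<in> Basis" "c \<in> Basis" shows "\<bar>(x \<bullet> b) * (y \<bullet> c)\<bar> \<le> norm x * norm y"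
  using assms by (auto simp: abs_mult intro!: mult_mono Basis_le_norm)

text \<open>The field is paired with its own value. The constant 8 collects a 2 from the gradient
  formula, a 2 from \<open>abs_tp_form_le\<close> and a 2 from the symmetrized product.\<close>

lemma norm_tp_grad_le:
  fixes x :: "'a::euclidean_space"
  shows "norm (tp_grad m x) \<le> 8 * (real DIM('a))\<^sup>2 * entry_sum m * norm x"
proof -
  define h where "h = tp_grad m x"
  have "norm h * norm h = tp_grad m x \<bullet> h" by (simp add: h_def dot_square_norm power2_eq_square)
  also have "\<dots> \<le> 2 * \<bar>tp_form m (\<lambda>b c. (x \<bullet> b) * (h \<bullet> c) + (h \<bullet> b) * (x \<bullet> c))\<bar>"
    unfolding inner_tp_grad by simp
  also have "\<dots> \<le> 2 * (2 * (entry_sum m * entry_sum (\<lambda>b c. (x \<bullet> b) * (h \<bullet> c) + (h \<bullet> b) * (x \<bullet> c))))"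
    by (intro mult_left_mono abs_tp_form_le) simp
  also have "\<dots> \<le> 2 * (2 * (entry_sum m * ((real DIM('a))\<^sup>2 * (2 * (norm x * norm h)))))"
  proof -
    have bd: "\<bar>(x \<bullet> b) * (h \<bullet> c) + (h \<bullet> b) * (x \<bullet> c)\<bar> \<le> 2 * (norm x * norm h)"
      if "b \<in> Basis" "c \<in> Basis" for b c
      using abs_inner_mult_le[OF that, of x h] abs_inner_mult_le[OF that, of h x]
      unfolding mult.commute[of "norm h"] by linarith
    show ?thesis by (intro mult_left_mono entry_sum_le bd entry_sum_nonneg) auto
  qed
  also have "\<dots> = (8 * (real DIM('a))\<^sup>2 * entry_sum m * norm x) * norm h" by simp
  finally have "norm h * norm h \<le> (8 * (real DIM('a))\<^sup>2 * entry_sum m * norm x) * norm h" .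
  then have "norm h \<le> 8 * (real DIM('a))\<^sup>2 * entry_sum m * norm x"
    by (cases "h = 0") (auto simp: entry_sum_nonneg)
  then show ?thesis by (simp add: h_def)
qed

lemma continuous_on_tp_grad [continuous_intros]:
  "continuous_on S f \<Longrightarrow> continuous_on S (\<lambda>x. tp_grad m (f x))"
  unfolding tp_grad_def tp_form_def by (intro continuous_intros) auto

text \<open>Linearity in \<open>m\<close> turns a comparison of the gradient fields of two measures
  into a bound by the difference of their moments.\<close>

lemma tp_grad_diff: "tp_grad m x - tp_grad n x = tp_grad (\<lambda>b c. m b c - n b c) x"
proof -
  have "tp_form m u - tp_form n u = tp_form (\<lambda>b c. m b c - n b c) u" for u
    using tp_form_add[of u "\<lambda>b c. m b c - n b c" n]
    by (simp add: tp_form_commute[of m u] tp_form_commute[of n u]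
        tp_form_commute[of "\<lambda>b c. m b c - n b c" u])
  then show ?thesis by (simp add: tp_grad_def flip: sum_subtractf scaleR_left_diff_distrib right_diff_distrib)
qed

section \<open>Expansion of the tightness potential\<close>

lemma integrable_norm_mult:
  fixes X H :: "'w \<Rightarrow> 'a::euclidean_space"
  assumes [measurable]: "X \<in> borel_measurable M" "H \<in> borel_measurable M"
    and "integrable M (\<lambda>w. (norm (X w))\<^sup>2)" "integrable M (\<lambda>w. (norm (H w))\<^sup>2)"
  shows "integrable M (\<lambda>w. norm (X w) * norm (H w))"
proof (rule Bochner_Integration.integrable_bound)
  show "integrable M (\<lambda>w. (norm (X w))\<^sup>2 + (norm (H w))\<^sup>2)" using assms by simp
  have "a * b \<le> a\<^sup>2 + b\<^sup>2" if "0 \<le> a" "0 \<le> b" for a b :: real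
    using sum_squares_bound[of a b] mult_nonneg_nonneg[OF that] by linarith
  then show "AE w in M. norm (norm (X w) * norm (H w)) \<le> norm ((norm (X w))\<^sup>2 + (norm (H w))\<^sup>2)"
    by simp
qed simp

lemma integrable_coord_mult:
  fixes X H :: "'w \<Rightarrow> 'a::euclidean_space"
  assumes [measurable]: "X \<in> borel_measurable M" "H \<in> borel_measurable M"
    and "integrable M (\<lambda>w. (norm (X w))\<^sup>2)" "integrable M (\<lambda>w. (norm (H w))\<^sup>2)"
    and "b \<in> Basis" "c \<in> Basis"
  shows "integrable M (\<lambda>w. (X w \<bullet> b) * (H w \<bullet> c))"
  by (rule Bochner_Integration.integrable_bound[OF integrable_norm_mult[OF assms(1-4)]])
    (auto simp: abs_mult intro!: AE_I2 mult_mono Basis_le_norm assms)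

lemma TP_eq_tp_form:
  fixes \<mu> :: "'a::euclidean_space measure"
  assumes S: "sets \<mu> = sets borel" and i: "integrable \<mu> (\<lambda>x. (norm x)\<^sup>2)"
  shows "TP \<mu> = ereal (tp_form (moment \<mu>) (moment \<mu>))"
proof -
  have [measurable_cong]: "sets \<mu> = sets borel" by fact
  have ii: "integrable \<mu> (\<lambda>x. (x \<bullet> b) * (x \<bullet> c))" if "b \<in> Basis" "c \<in> Basis" for b c
    by (rule integrable_coord_mult) (use i that in auto)
  \<comment> \<open>The kernel of TP is the form evaluated at two rank-one matrices; bilinearity
    then lets both integrals pass to the moments.\<close>
  have kernel: "(x \<bullet> y)\<^sup>2 - (1 / real DIM('a)) * (norm x)\<^sup>2 * (norm y)\<^sup>2
      = tp_form (\<lambda>b c. (x \<bullet> b) * (x \<bullet> c)) (\<lambda>b c. (y \<bullet> b) * (y \<bullet> c))" for x y :: 'a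
  proof -
    have n: "(norm z)\<^sup>2 = (\<Sum>b\<in>Basis. (z \<bullet> b) * (z \<bullet> b))" for z :: 'a
      unfolding power2_norm_eq_inner by (rule euclidean_inner)
    have "(x \<bullet> y)\<^sup>2 = (\<Sum>b\<in>Basis. (x \<bullet> b) * (y \<bullet> b)) * (\<Sum>c\<in>Basis. (x \<bullet> c) * (y \<bullet> c))"
      unfolding power2_eq_square by (subst (1 2) euclidean_inner) simp
    also have "\<dots> = (\<Sum>b\<in>Basis. \<Sum>c\<in>Basis. ((x \<bullet> b) * (x \<bullet> c)) * ((y \<bullet> b) * (y \<bullet> c)))"
      by (simp add: sum_product mult_ac)
    finally show ?thesis by (simp add: tp_form_def n)
  qed
  have tpi: "(\<integral>y. tp_form m (\<lambda>b c. (y \<bullet> b) * (y \<bullet> c)) \<partial>\<mu>) = tp_form m (moment \<mu>)" for m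
    unfolding moment_def[abs_def] by (rule tp_form_integral) (rule ii)
  have "(\<integral>x. \<integral>y. tp_form (\<lambda>b c. (x \<bullet> b) * (x \<bullet> c)) (\<lambda>b c. (y \<bullet> b) * (y \<bullet> c)) \<partial>\<mu> \<partial>\<mu>)
     = tp_form (moment \<mu>) (moment \<mu>)"
    unfolding tpi by (subst tp_form_commute) (rule tpi)
  then show ?thesis unfolding TP_def kernel by simp
qed

lemma entry_sum_moment_le:
  fixes \<mu> :: "'a::euclidean_space measure"
  assumes S: "sets \<mu> = sets borel" and i: "integrable \<mu> (\<lambda>x. (norm x)\<^sup>2)"
  shows "entry_sum (moment \<mu>) \<le> (real DIM('a))\<^sup>2 * (\<integral>x. (norm x)\<^sup>2 \<partial>\<mu>)"
proof (rule entry_sum_le)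
  have [measurable_cong]: "sets \<mu> = sets borel" by fact
  fix b c :: 'a assume bc: "b \<in> Basis" "c \<in> Basis"
  have "\<bar>moment \<mu> b c\<bar> \<le> (\<integral>x. \<bar>(x \<bullet> b) * (x \<bullet> c)\<bar> \<partial>\<mu>)"
    unfolding moment_def by (rule integral_abs_bound)
  also have "\<dots> \<le> (\<integral>x. (norm x)\<^sup>2 \<partial>\<mu>)"
    using abs_inner_mult_le[OF bc] i integrable_coord_mult[of "\<lambda>x. x" \<mu> "\<lambda>x. x", OF _ _ i i bc]
    by (intro integral_mono) (auto simp: power2_eq_square)
  finally show "\<bar>moment \<mu> b c\<bar> \<le> (\<integral>x. (norm x)\<^sup>2 \<partial>\<mu>)" .
qed

text \<open>A base variable and a displacement on an abstract probability space. This covers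
  couplings read from either side as well as shifts of a plan by a function of both its coordinates.
  The number \<open>s\<close> is any positive bound for the mean-square size of the
  displacement.\<close>

locale perturbation = prob_space M for M :: "'w measure" +
  fixes X H :: "'w \<Rightarrow> 'a::euclidean_space" and s :: real
  assumes X [measurable]: "X \<in> borel_measurable M" and H [measurable]: "H \<in> borel_measurable M"
    and X2: "integrable M (\<lambda>w. (norm (X w))\<^sup>2)" and H2: "integrable M (\<lambda>w. (norm (H w))\<^sup>2)"
    and s: "0 < s" and Hs: "(\<integral>w. (norm (H w))\<^sup>2 \<partial>M) \<le> s\<^sup>2"
begin

abbreviation "\<mu> \<equiv> distr M borel X"
abbreviation "\<nu> \<equiv> distr M borel (\<lambda>w. X w + H w)"
abbreviation "K \<equiv> \<integral>w. (norm (X w))\<^sup>2 \<partial>M"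

lemma K_eq: "(\<integral>x. (norm x)\<^sup>2 \<partial>\<mu>) = K" by (simp add: integral_distr)

lemma K_nonneg: "0 \<le> K" by simp

lemma integrable_\<mu>: "integrable \<mu> (\<lambda>x. (norm x)\<^sup>2)" using X2 by (simp add: integrable_distr_eq)

text \<open>Arithmetic-geometric mean inequality with weight \<open>s\<close>, chosen so that both
  resulting terms are of order \<open>s\<close>.\<close>

lemma integral_norm_mult_le: "(\<integral>w. norm (X w) * norm (H w) \<partial>M) \<le> s * (K + 1) / 2"
proof -
  have "(\<integral>w. norm (X w) * norm (H w) \<partial>M) \<le> (\<integral>w. s / 2 * (norm (X w))\<^sup>2 + 1 / (2 * s) * (norm (H w))\<^sup>2 \<partial>M)"
  proof (rule integral_mono)
    fix w
    have "2 * (s * norm (X w)) * norm (H w) \<le> (s * norm (X w))\<^sup>2 + (norm (H w))\<^sup>2"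
      by (rule sum_squares_bound)
    then show "norm (X w) * norm (H w) \<le> s / 2 * (norm (X w))\<^sup>2 + 1 / (2 * s) * (norm (H w))\<^sup>2"
      using s by (simp add: field_simps power2_eq_square)
  qed (use X2 H2 integrable_norm_mult[OF X H X2 H2] in auto)
  also have "\<dots> = s / 2 * K + 1 / (2 * s) * (\<integral>w. (norm (H w))\<^sup>2 \<partial>M)"
    using X2 H2 by simp
  also have "\<dots> \<le> s / 2 * K + 1 / (2 * s) * s\<^sup>2"
    using s Hs by (intro add_left_mono mult_left_mono) auto
  also have "\<dots> = s * (K + 1) / 2" using s by (simp add: field_simps power2_eq_square)
  finally show ?thesis .
qed

abbreviation "cross b c \<equiv> \<integral>w. (X w \<bullet> b) * (H w \<bullet> c) + (H w \<bullet> b) * (X w \<bullet> c) \<partial>M"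
abbreviation "square b c \<equiv> \<integral>w. (H w \<bullet> b) * (H w \<bullet> c) \<partial>M"

lemma moment_diff:
  assumes bc: "b \<in> Basis" "c \<in> Basis"
  shows "moment \<nu> b c - moment \<mu> b c = cross b c + square b c"
proof -
  note i = integrable_coord_mult[OF X X X2 X2 bc] integrable_coord_mult[OF X H X2 H2 bc]
    integrable_coord_mult[OF H X H2 X2 bc] integrable_coord_mult[OF H H H2 H2 bc]
  have "moment \<nu> b c = (\<integral>w. (X w \<bullet> b) * (X w \<bullet> c) + ((X w \<bullet> b) * (H w \<bullet> c) + (H w \<bullet> b) * (X w \<bullet> c)) + (H w \<bullet> b) * (H w \<bullet> c) \<partial>M)"
    by (simp add: moment_def integral_distr inner_add_left algebra_simps)
  also have "\<dots> = moment \<mu> b c + cross b c + square b c"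
    using i by (simp add: moment_def integral_distr)
  finally show ?thesis by simp
qed

lemma abs_square_le:
  assumes bc: "b \<in> Basis" "c \<in> Basis" shows "\<bar>square b c\<bar> \<le> s\<^sup>2"
proof -
  have "\<bar>square b c\<bar> \<le> (\<integral>w. \<bar>(H w \<bullet> b) * (H w \<bullet> c)\<bar> \<partial>M)" by (rule integral_abs_bound)
  also have "\<dots> \<le> (\<integral>w. (norm (H w))\<^sup>2 \<partial>M)"
    using abs_inner_mult_le[OF bc] H2 integrable_coord_mult[OF H H H2 H2 bc]
    by (intro integral_mono) (auto simp: power2_eq_square)
  finally show ?thesis using Hs by linarith
qed

lemma abs_moment_diff_le:
  assumes bc: "b \<in> Basis" "c \<in> Basis"
  shows "\<bar>moment \<nu> b c - moment \<mu> b c\<bar> \<le> s * (K + 1) + s\<^sup>2"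
proof -
  have "\<bar>cross b c\<bar> \<le> (\<integral>w. \<bar>(X w \<bullet> b) * (H w \<bullet> c) + (H w \<bullet> b) * (X w \<bullet> c)\<bar> \<partial>M)"
    by (rule integral_abs_bound)
  also have "\<dots> \<le> (\<integral>w. 2 * (norm (X w) * norm (H w)) \<partial>M)"
  proof (rule integral_mono)
    show "\<bar>(X w \<bullet> b) * (H w \<bullet> c) + (H w \<bullet> b) * (X w \<bullet> c)\<bar> \<le> 2 * (norm (X w) * norm (H w))" for w
      using abs_inner_mult_le[OF bc, of "X w" "H w"] abs_inner_mult_le[OF bc, of "H w" "X w"]
      unfolding mult.commute[of "norm (H w)"] by linarith
  qed (use integrable_norm_mult[OF X H X2 H2] integrable_coord_mult[OF X H X2 H2 bc]
      integrable_coord_mult[OF H X H2 X2 bc] in auto)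
  also have "\<dots> \<le> s * (K + 1)" using integral_norm_mult_le by simp
  finally show ?thesis using abs_square_le[OF bc] moment_diff[OF bc] by linarith
qed

text \<open>With \<open>D\<close> the change of the moment matrix, the form changes by
  \<open>2 * tp_form m D + tp_form D D\<close>. The cross part of \<open>D\<close> integrates
  exactly to the gradient term, leaving \<open>2 * tp_form m square + tp_form D D\<close>. The first
  is of order \<open>s\<^sup>2\<close> because \<open>square\<close> is, the second because
  \<open>D\<close> is of order \<open>s\<close>; there \<open>s \<le> 1\<close> turns
  \<open>s * (K + 1) + s\<^sup>2\<close> into \<open>s * (K + 2)\<close>. Each of the two matrix
  norms in a product contributes a squared dimension.\<close>

lemma tp_expansion:
  assumes s1: "s \<le> 1"
  shows "\<bar>tp_form (moment \<nu>) (moment \<nu>) - tp_form (moment \<mu>) (moment \<mu>)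
      - (\<integral>w. tp_grad (moment \<mu>) (X w) \<bullet> H w \<partial>M)\<bar> \<le> (real DIM('a)) ^ 4 * (4 * K + 2 * (K + 2)\<^sup>2) * s\<^sup>2"
proof -
  define m where "m = moment \<mu>"
  define D where "D b c = moment \<nu> b c - m b c" for b c
  let ?d = "real DIM('a)"
  have n: "moment \<nu> = (\<lambda>b c. m b c + D b c)" by (simp add: D_def)
  have "tp_form (moment \<nu>) (moment \<nu>) = tp_form (moment \<nu>) m + tp_form (moment \<nu>) D"
    by (subst (2) n) (rule tp_form_add)
  also have "\<dots> = tp_form m (moment \<nu>) + tp_form D (moment \<nu>)" by (simp only: tp_form_commute)
  also have "\<dots> = tp_form m m + tp_form m D + (tp_form D m + tp_form D D)"
    unfolding n tp_form_add ..
  finally have 1: "tp_form (moment \<nu>) (moment \<nu>) - tp_form m m = 2 * tp_form m D + tp_form D D"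
    by (simp add: tp_form_commute[of D m])
  have "tp_form m D = tp_form m (\<lambda>b c. cross b c + square b c)"
    unfolding tp_form_def D_def m_def by (simp add: moment_diff cong: sum.cong)
  also have "\<dots> = tp_form m cross + tp_form m square" by (rule tp_form_add)
  finally have 2: "tp_form m D = tp_form m cross + tp_form m square" .
  have 3: "2 * tp_form m cross = (\<integral>w. tp_grad m (X w) \<bullet> H w \<partial>M)"
    unfolding inner_tp_grad
    using integrable_coord_mult[OF X H X2 H2] integrable_coord_mult[OF H X H2 X2]
    by (subst integral_mult_right_zero, subst tp_form_integral) auto
  have "tp_form (moment \<nu>) (moment \<nu>) - tp_form m m - (\<integral>w. tp_grad m (X w) \<bullet> H w \<partial>M)
      = 2 * tp_form m square + tp_form D D" using 1 2 3 by simp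
  moreover have "\<bar>tp_form m square\<bar> \<le> 2 * (?d\<^sup>2 * K * (?d\<^sup>2 * s\<^sup>2))"
  proof -
    have "entry_sum m \<le> ?d\<^sup>2 * K"
      using entry_sum_moment_le[OF _ integrable_\<mu>] unfolding m_def K_eq by simp
    moreover have "entry_sum square \<le> ?d\<^sup>2 * s\<^sup>2" by (intro entry_sum_le abs_square_le)
    ultimately show ?thesis using K_nonneg
      by (intro order_trans[OF abs_tp_form_le] mult_left_mono mult_mono) (auto simp: entry_sum_nonneg)
  qed
  moreover have "\<bar>tp_form D D\<bar> \<le> 2 * (?d\<^sup>2 * (s * (K + 2)) * (?d\<^sup>2 * (s * (K + 2))))"
  proof -
    have "s\<^sup>2 \<le> s" using s s1 by (simp add: power2_eq_square mult_left_le)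
    then have "\<bar>D b c\<bar> \<le> s * (K + 2)" if "b \<in> Basis" "c \<in> Basis" for b c
      using abs_moment_diff_le[OF that] by (simp add: D_def m_def algebra_simps)
    then have "entry_sum D \<le> ?d\<^sup>2 * (s * (K + 2))" by (rule entry_sum_le)
    then show ?thesis using K_nonneg s
      by (intro order_trans[OF abs_tp_form_le] mult_left_mono mult_mono) (auto simp: entry_sum_nonneg)
  qed
  moreover have "2 * (2 * (?d\<^sup>2 * K * (?d\<^sup>2 * s\<^sup>2))) + 2 * (?d\<^sup>2 * (s * (K + 2)) * (?d\<^sup>2 * (s * (K + 2))))
     = ?d ^ 4 * (4 * K + 2 * (K + 2)\<^sup>2) * s\<^sup>2"
    by (simp add: power2_eq_square power4_eq_xxxx algebra_simps)
  ultimately show ?thesis unfolding m_def by linarith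
qed

end

section \<open>Wasserstein convergence\<close>

lemma (in perturbation) integral_norm_le: "(\<integral>w. norm (H w) \<partial>M) \<le> s"
proof -
  have bd: "norm (H w) \<le> s / 2 + 1 / (2 * s) * (norm (H w))\<^sup>2" for w
  proof -
    have "2 * s * norm (H w) \<le> s\<^sup>2 + (norm (H w))\<^sup>2" by (rule sum_squares_bound)
    then show ?thesis using s by (simp add: field_simps power2_eq_square)
  qed
  have "integrable M (\<lambda>w. s / 2 + 1 / (2 * s) * (norm (H w))\<^sup>2)" using H2 by simp
  moreover from this have "integrable M (\<lambda>w. norm (H w))"
    by (rule Bochner_Integration.integrable_bound) (use bd in \<open>auto intro!: AE_I2 order_trans[OF bd]\<close>)
  ultimately have "(\<integral>w. norm (H w) \<partial>M) \<le> (\<integral>w. s / 2 + 1 / (2 * s) * (norm (H w))\<^sup>2 \<partial>M)"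
    using bd by (intro integral_mono)
  also have "\<dots> = s / 2 + 1 / (2 * s) * (\<integral>w. (norm (H w))\<^sup>2 \<partial>M)"
    using H2 by (simp add: prob_space)
  also have "\<dots> \<le> s / 2 + 1 / (2 * s) * s\<^sup>2"
    using s Hs by (intro add_left_mono mult_left_mono) auto
  also have "\<dots> = s" using s by (simp add: field_simps power2_eq_square)
  finally show ?thesis .
qed

section \<open>From p-th moments to second moments\<close>

lemma powr_le_one_plus_powr:
  fixes a :: real
  assumes "0 \<le> a" "0 < q" "q \<le> p" shows "a powr q \<le> 1 + a powr p"
proof (cases "a \<le> 1")
  case True
  then have "a powr q \<le> 1 powr q" using assms by (intro powr_mono2) auto
  then show ?thesis using powr_ge_zero[of a p] by (simp del: powr_ge_zero)
next
  case False
  then have "a powr q \<le> a powr p" using assms by (intro powr_mono) auto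
  then show ?thesis by simp
qed

text \<open>The pointwise bound \<open>a\<^sup>2 \<le> 1 + a powr p\<close>, rescaled by
  \<open>W\<close>, stands in for Jensen's inequality. It costs the factor 2, which is harmless
  because only the order in \<open>W\<close> matters.\<close>

lemma square_integral_le:
  fixes H :: "'w \<Rightarrow> 'a::euclidean_space"
  assumes "prob_space M" and [measurable]: "H \<in> borel_measurable M" and p: "p \<ge> 2" and W: "W > 0"
    and le: "(\<integral>\<^sup>+w. ennreal (norm (H w) powr p) \<partial>M) \<le> ennreal (W powr p)"
  shows "integrable M (\<lambda>w. (norm (H w))\<^sup>2)" "(\<integral>w. (norm (H w))\<^sup>2 \<partial>M) \<le> 2 * W\<^sup>2"
proof -
  interpret prob_space M by fact
  have bd: "(norm h)\<^sup>2 \<le> W\<^sup>2 + W\<^sup>2 / W powr p * norm h powr p" for h :: 'a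
  proof -
    have "(norm h / W) powr 2 \<le> 1 + (norm h / W) powr p"
      using p W by (intro powr_le_one_plus_powr) auto
    then have "(norm h)\<^sup>2 / W\<^sup>2 \<le> 1 + norm h powr p / W powr p"
      using W by (simp add: powr_divide power_divide)
    then show ?thesis using W by (simp add: field_simps)
  qed
  have "(\<integral>\<^sup>+w. ennreal ((norm (H w))\<^sup>2) \<partial>M)
      \<le> (\<integral>\<^sup>+w. ennreal (W\<^sup>2) + ennreal (W\<^sup>2 / W powr p) * ennreal (norm (H w) powr p) \<partial>M)"
    using bd by (intro nn_integral_mono) (simp flip: ennreal_plus ennreal_mult'')
  also have "\<dots> = ennreal (W\<^sup>2) + ennreal (W\<^sup>2 / W powr p) * (\<integral>\<^sup>+w. ennreal (norm (H w) powr p) \<partial>M)"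
    by (simp add: nn_integral_add nn_integral_cmult emeasure_space_1)
  also have "\<dots> \<le> ennreal (W\<^sup>2) + ennreal (W\<^sup>2 / W powr p) * ennreal (W powr p)"
    by (intro add_left_mono mult_left_mono le) auto
  also have "\<dots> = ennreal (2 * W\<^sup>2)" using W by (simp flip: ennreal_plus ennreal_mult'')
  finally have n: "(\<integral>\<^sup>+w. ennreal ((norm (H w))\<^sup>2) \<partial>M) \<le> ennreal (2 * W\<^sup>2)" .
  then show "integrable M (\<lambda>w. (norm (H w))\<^sup>2)"
    by (intro integrableI_bounded) (auto intro: le_less_trans)
  then have "ennreal (\<integral>w. (norm (H w))\<^sup>2 \<partial>M) \<le> ennreal (2 * W\<^sup>2)"
    using n by (subst nn_integral_eq_integral[symmetric]) auto
  then show "(\<integral>w. (norm (H w))\<^sup>2 \<partial>M) \<le> 2 * W\<^sup>2" by (simp add: ennreal_le_iff)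
qed

lemma square_integrable_of_powr:
  fixes H :: "'w \<Rightarrow> 'a::euclidean_space"
  assumes "prob_space M" "H \<in> borel_measurable M" and p: "p \<ge> 2"
    and fin: "(\<integral>\<^sup>+w. ennreal (norm (H w) powr p) \<partial>M) < \<infinity>"
  shows "integrable M (\<lambda>w. (norm (H w))\<^sup>2)"
proof -
  define I where "I = enn2real (\<integral>\<^sup>+w. ennreal (norm (H w) powr p) \<partial>M)"
  have "(\<integral>\<^sup>+w. ennreal (norm (H w) powr p) \<partial>M) = ennreal I"
    unfolding I_def using fin by simp
  \<comment> \<open>The added 1 keeps the scale positive when \<open>I = 0\<close>.\<close>
  also have "\<dots> \<le> ennreal (((I + 1) powr (1 / p)) powr p)"
    using p by (intro ennreal_leI) (simp add: powr_powr I_def)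
  finally show ?thesis using p
    by (intro square_integral_le(1)[OF assms(1-3), of "(I + 1) powr (1 / p)"])
      (simp_all add: I_def add_nonneg_eq_0_iff)
qed

lemma Pp_square_integrable:
  assumes "p \<ge> 2" "\<mu> \<in> Pp p" shows "integrable \<mu> (\<lambda>x. (norm x)\<^sup>2)"
  using PpD[OF assms(2)] assms(1) measurable_cong_sets[OF PpD(2)[OF assms(2)] refl]
  by (intro square_integrable_of_powr) auto

lemma TP_Pp:
  assumes "p \<ge> 2" "\<mu> \<in> Pp p"
  shows "TP \<mu> = ereal (tp_form (moment \<mu>) (moment \<mu>))"
  by (rule TP_eq_tp_form[OF PpD(2)[OF assms(2)] Pp_square_integrable[OF assms]])

text \<open>The factor \<open>sqrt 2\<close> absorbs the constant of
  \<open>square_integral_le\<close>. Reading the coupling from \<open>fst\<close> serves the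
  subdifferential inequality at \<open>\<mu>\<close>; reading it from \<open>snd\<close> serves
  convergence towards a fixed measure.\<close>

lemma optimal_perturbation:
  fixes \<mu> \<nu> :: "'a::euclidean_space measure"
  assumes p: "p \<ge> 2" and m: "\<mu> \<in> Pp p" and n: "\<nu> \<in> Pp p"
    and c: "\<pi> \<in> couplings \<mu> \<nu>" and cost: "transport_cost p \<pi> = ennreal (Wp p \<mu> \<nu> powr p)"
    and W: "Wp p \<mu> \<nu> \<le> W" "W > 0"
  shows "perturbation \<pi> fst (\<lambda>z. snd z - fst z) (sqrt 2 * W)"
    "perturbation \<pi> snd (\<lambda>z. fst z - snd z) (sqrt 2 * W)"
proof -
  note cD = couplingsD[OF c]
  have [measurable_cong]: "sets \<pi> = sets borel" by (rule cD)
  have [measurable]: "fst \<in> borel_measurable \<pi>" "snd \<in> borel_measurable \<pi>" by measurable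
  have "0 \<le> Wp p \<mu> \<nu>" by (simp add: Wp_def)
  then have "(\<integral>\<^sup>+z. ennreal (norm (fst z - snd z) powr p) \<partial>\<pi>) \<le> ennreal (W powr p)"
    using cost W p unfolding transport_cost_def by (auto intro!: ennreal_leI powr_mono2)
  from square_integral_le[OF cD(1) _ p W(2) this]
  have d: "integrable \<pi> (\<lambda>z. (norm (fst z - snd z))\<^sup>2)" "(\<integral>z. (norm (fst z - snd z))\<^sup>2 \<partial>\<pi>) \<le> (sqrt 2 * W)\<^sup>2"
    by (simp_all add: power_mult_distrib)
  have i: "integrable \<pi> (\<lambda>z. (norm (fst z))\<^sup>2)" "integrable \<pi> (\<lambda>z. (norm (snd z))\<^sup>2)"
    using Pp_square_integrable[OF p m] Pp_square_integrable[OF p n]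
    unfolding cD(3)[symmetric] cD(4)[symmetric] by (simp_all add: integrable_distr_eq)
  show "perturbation \<pi> snd (\<lambda>z. fst z - snd z) (sqrt 2 * W)"
    using d i W by (intro perturbation.intro perturbation_axioms.intro cD) auto
  show "perturbation \<pi> fst (\<lambda>z. snd z - fst z) (sqrt 2 * W)"
    using d i W by (intro perturbation.intro perturbation_axioms.intro cD) (auto simp: norm_minus_commute)
qed

text \<open>The limit measure is taken as the base, so the second moment entering the estimates is
  the same for all \<open>n\<close>.\<close>

lemma conv_Pp_D:
  fixes \<mu>s :: "nat \<Rightarrow> 'a::euclidean_space measure"
  assumes p: "p \<ge> 2" and conv: "conv_Pp p \<mu>s \<mu>"
  obtains \<pi> s where "\<And>n. \<pi> n \<in> couplings (\<mu>s n) \<mu>"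
    "\<And>n. perturbation (\<pi> n) snd (\<lambda>z. fst z - snd z) (s n)" "s \<longlonglongrightarrow> 0"
proof -
  have m: "\<mu>s n \<in> Pp p" "\<mu> \<in> Pp p" for n using conv by (auto simp: conv_Pp_def)
  have "\<exists>\<pi>. \<pi> \<in> couplings (\<mu>s n) \<mu> \<and> transport_cost p \<pi> = ennreal (Wp p (\<mu>s n) \<mu> powr p)" for n
    using optimal_coupling_exists[OF _ m(1)[of n] m(2)] p by (force simp: optimal_couplings_def)
  then obtain \<pi> where pi: "\<And>n. \<pi> n \<in> couplings (\<mu>s n) \<mu>"
    "\<And>n. transport_cost p (\<pi> n) = ennreal (Wp p (\<mu>s n) \<mu> powr p)" by metis
  \<comment> \<open>The summand \<open>1 / real (Suc n)\<close> makes the scale positive even if the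
    distance vanishes, and it disappears in the limit.\<close>
  have "perturbation (\<pi> n) snd (\<lambda>z. fst z - snd z) (sqrt 2 * (Wp p (\<mu>s n) \<mu> + 1 / real (Suc n)))" for n
  proof (rule optimal_perturbation(2)[OF p m(1) m(2) pi])
    show "0 < Wp p (\<mu>s n) \<mu> + 1 / real (Suc n)"
      by (intro add_nonneg_pos) (auto simp: Wp_def)
  qed simp
  moreover have "(\<lambda>n. sqrt 2 * (Wp p (\<mu>s n) \<mu> + 1 / real (Suc n))) \<longlonglongrightarrow> sqrt 2 * (0 + 0)"
    using conv unfolding conv_Pp_def by (intro tendsto_intros LIMSEQ_Suc[OF lim_1_over_n]) auto
  ultimately show thesis
    using pi(1) by (intro that[of \<pi> "\<lambda>n. sqrt 2 * (Wp p (\<mu>s n) \<mu> + 1 / real (Suc n))"]) simp_all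
qed

lemma coupling_distr_add:
  fixes \<pi> :: "('a::euclidean_space \<times> 'a) measure"
  assumes "\<pi> \<in> couplings \<mu> \<nu>"
  shows "distr \<pi> borel (\<lambda>z. fst z + (snd z - fst z)) = \<nu>" "distr \<pi> borel (\<lambda>z. snd z + (fst z - snd z)) = \<mu>"
  using couplingsD[OF assms] by simp_all

lemma moment_tendsto:
  fixes \<mu>s :: "nat \<Rightarrow> 'a::euclidean_space measure"
  assumes p: "p \<ge> 2" and conv: "conv_Pp p \<mu>s \<mu>" and bc: "b \<in> Basis" "c \<in> Basis"
  shows "(\<lambda>n. moment (\<mu>s n) b c) \<longlonglongrightarrow> moment \<mu> b c"
proof -
  obtain \<pi> s where pi: "\<And>n. \<pi> n \<in> couplings (\<mu>s n) \<mu>"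
    and P: "\<And>n. perturbation (\<pi> n) snd (\<lambda>z. fst z - snd z) (s n)" and s: "s \<longlonglongrightarrow> 0"
    using conv_Pp_D[OF p conv] by blast
  define K where "K = (\<integral>x. (norm x)\<^sup>2 \<partial>\<mu>)"
  have "(\<integral>z. (norm (snd z))\<^sup>2 \<partial>\<pi> n) = K" for n
    unfolding K_def by (rule coupling_distr(2)[OF pi]) simp
  then have est: "\<bar>moment (\<mu>s n) b c - moment \<mu> b c\<bar> \<le> s n * (K + 1) + (s n)\<^sup>2" for n
    using perturbation.abs_moment_diff_le[OF P[of n] bc]
    unfolding coupling_distr_add[OF pi] couplingsD(4)[OF pi] by simp
  have "(\<lambda>n. s n * (K + 1) + (s n)\<^sup>2) \<longlonglongrightarrow> 0 * (K + 1) + 0\<^sup>2"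
    by (intro tendsto_intros s)
  then have "(\<lambda>n. s n * (K + 1) + (s n)\<^sup>2) \<longlonglongrightarrow> 0" by simp
  then have "(\<lambda>n. moment (\<mu>s n) b c - moment \<mu> b c) \<longlonglongrightarrow> 0"
    by (rule Lim_null_comparison[rotated]) (simp add: est)
  then show ?thesis by (rule LIM_zero_cancel)
qed

lemma TP_tendsto:
  fixes \<mu>s :: "nat \<Rightarrow> 'a::euclidean_space measure"
  assumes p: "p \<ge> 2" and conv: "conv_Pp p \<mu>s \<mu>"
  shows "(\<lambda>n. TP (\<mu>s n)) \<longlonglongrightarrow> TP \<mu>"
proof -
  have m: "\<mu>s n \<in> Pp p" "\<mu> \<in> Pp p" for n using conv by (auto simp: conv_Pp_def)
  have "(\<lambda>n. tp_form (moment (\<mu>s n)) (moment (\<mu>s n))) \<longlonglongrightarrow> tp_form (moment \<mu>) (moment \<mu>)"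
    unfolding tp_form_def by (intro tendsto_intros moment_tendsto[OF p conv]) auto
  then show ?thesis unfolding TP_Pp[OF p m(1)] TP_Pp[OF p m(2)] by simp
qed

lemma proper_lsc_TP:
  assumes p: "p \<ge> 2"
  shows "proper_lsc p (TP :: 'a::euclidean_space measure \<Rightarrow> ereal)"
  unfolding proper_lsc_def
proof (intro conjI ballI allI impI)
  show "TP \<mu> \<noteq> -\<infinity>" for \<mu> :: "'a measure" by (simp add: TP_def)
  have "return borel (0 :: 'a) \<in> Pp p"
    using p by (auto simp: Pp_def prob_space_return nn_integral_return)
  then show "\<exists>\<mu> \<in> Pp p. TP (\<mu> :: 'a measure) < \<infinity>" by (rule bexI[rotated]) (simp add: TP_def)
  fix \<mu>s and \<mu> :: "'a measure" assume "conv_Pp p \<mu>s \<mu>"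
  from lim_imp_Liminf[OF _ TP_tendsto[OF p this]]
  show "TP \<mu> \<le> liminf (\<lambda>n. TP (\<mu>s n))" by simp
qed

text \<open>A Lipschitz test function changes along a coupling by at most its constant times the
  mean displacement, so convergence in \<open>Wp\<close> passes its integrals to the limit. Narrow
  convergence of the plans gives the same integrals the limit under the marginal of
  \<open>\<gamma>\<close>.\<close>

lemma narrow_marginal:
  fixes \<mu>s :: "nat \<Rightarrow> 'a::euclidean_space measure"
  assumes p: "p \<ge> 2" and conv: "conv_Pp p \<mu>s \<mu>" and narrow: "narrow_conv \<gamma>s \<gamma>"
    and marg: "\<And>n. distr (\<gamma>s n) borel fst = \<mu>s n"
  shows "distr \<gamma> borel fst = \<mu>"
proof (rule borel_measure_eqI_Lipschitz)
  have \<gamma>: "prob_space \<gamma>" "sets \<gamma> = sets borel" "\<And>n. sets (\<gamma>s n) = sets borel"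
    using narrow by (auto simp: narrow_conv_def)
  have [measurable_cong]: "sets \<gamma> = sets borel" by fact
  have [measurable]: "fst \<in> borel_measurable \<gamma>" by measurable
  have mn: "fst \<in> borel_measurable (\<gamma>s n)" for n
    using measurable_fst_borel measurable_cong_sets[OF \<gamma>(3) refl] by blast
  have m: "\<mu>s n \<in> Pp p" "\<mu> \<in> Pp p" for n using conv by (auto simp: conv_Pp_def)
  show "prob_space (distr \<gamma> borel fst)" by (intro prob_space.prob_space_distr \<gamma>) measurable
  show "prob_space \<mu>" "sets \<mu> = sets borel" using PpD[OF m(2)] by auto
  obtain \<pi> s where pi: "\<And>n. \<pi> n \<in> couplings (\<mu>s n) \<mu>"
    and P: "\<And>n. perturbation (\<pi> n) snd (\<lambda>z. fst z - snd z) (s n)" and s: "s \<longlonglongrightarrow> 0"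
    using conv_Pp_D[OF p conv] by blast
  fix f :: "'a \<Rightarrow> real" and L
  assume f: "\<And>x. 0 \<le> f x \<and> f x \<le> 1" "\<And>x y. \<bar>f x - f y\<bar> \<le> L * norm (x - y)"
  have L: "\<bar>f x - f y\<bar> \<le> \<bar>L\<bar> * norm (x - y)" for x y
    using f(2)[of x y] mult_right_mono[OF abs_ge_self, of "norm (x - y)" L] by simp
  have fc: "continuous_on UNIV f"
    by (rule lipschitz_on_continuous_on[of "\<bar>L\<bar>"]) (auto intro!: lipschitz_onI simp: dist_norm L)
  have fm [measurable]: "f \<in> borel_measurable borel" using fc by (rule borel_measurable_continuous_onI)
  have est: "\<bar>(\<integral>x. f x \<partial>\<mu>s n) - (\<integral>x. f x \<partial>\<mu>)\<bar> \<le> \<bar>L\<bar> * s n" for n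
  proof -
    interpret perturbation "\<pi> n" snd "\<lambda>z. fst z - snd z" "s n" by (rule P)
    have [measurable_cong]: "sets (\<pi> n) = sets borel" by (rule couplingsD[OF pi])
    have [measurable]: "fst \<in> borel_measurable (\<pi> n)" "snd \<in> borel_measurable (\<pi> n)" by measurable
    have i: "integrable (\<pi> n) (\<lambda>z. f (fst z))" "integrable (\<pi> n) (\<lambda>z. f (snd z))"
      using f(1) by (auto intro!: integrable_const_bound[of _ 1])
    have iH: "integrable (\<pi> n) (\<lambda>z. norm (fst z - snd z))"
    proof (rule Bochner_Integration.integrable_bound)
      show "integrable (\<pi> n) (\<lambda>z. 1 + (norm (fst z - snd z))\<^sup>2)" using H2 by simp
      have "a \<le> 1 + a\<^sup>2" for a :: real using sum_squares_bound[of a 1] zero_le_power2[of a]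
        unfolding one_power2 mult_1_right by linarith
      then show "AE z in \<pi> n. norm (norm (fst z - snd z)) \<le> norm (1 + (norm (fst z - snd z))\<^sup>2)" by simp
    qed simp
    have "(\<integral>x. f x \<partial>\<mu>s n) - (\<integral>x. f x \<partial>\<mu>) = (\<integral>z. f (fst z) - f (snd z) \<partial>\<pi> n)"
      using i coupling_distr[OF pi fm] by simp
    also have "\<bar>\<dots>\<bar> \<le> (\<integral>z. \<bar>f (fst z) - f (snd z)\<bar> \<partial>\<pi> n)" by (rule integral_abs_bound)
    also have "\<dots> \<le> (\<integral>z. \<bar>L\<bar> * norm (fst z - snd z) \<partial>\<pi> n)"
      using i iH L by (intro integral_mono) auto
    also have "\<dots> \<le> \<bar>L\<bar> * s n" using integral_norm_le by (simp add: mult_left_mono)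
    finally show ?thesis .
  qed
  have "(\<lambda>n. \<bar>L\<bar> * s n) \<longlonglongrightarrow> 0" using tendsto_mult_left[OF s, of "\<bar>L\<bar>"] by simp
  then have "(\<lambda>n. (\<integral>x. f x \<partial>\<mu>s n) - (\<integral>x. f x \<partial>\<mu>)) \<longlonglongrightarrow> 0"
    by (rule Lim_null_comparison[rotated]) (simp add: est)
  then have A: "(\<lambda>n. \<integral>x. f x \<partial>\<mu>s n) \<longlonglongrightarrow> (\<integral>x. f x \<partial>\<mu>)" by (rule LIM_zero_cancel)
  have B: "(\<lambda>n. \<integral>z. f (fst z) \<partial>\<gamma>s n) \<longlonglongrightarrow> (\<integral>z. f (fst z) \<partial>\<gamma>)"
  proof -
    have "continuous_on UNIV (\<lambda>z::'a\<times>'a. f (fst z))"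
      by (rule continuous_on_compose2[OF fc]) (auto intro: continuous_intros)
    moreover have "bounded (range (\<lambda>z::'a\<times>'a. f (fst z)))"
      using f(1) by (auto simp: bounded_iff intro!: exI[of _ 1])
    ultimately show ?thesis using narrow unfolding narrow_conv_def by blast
  qed
  have "(\<integral>z. f (fst z) \<partial>\<gamma>s n) = (\<integral>x. f x \<partial>\<mu>s n)" for n
    unfolding marg[symmetric] using mn by (simp add: integral_distr)
  from B[unfolded this] A have "(\<integral>z. f (fst z) \<partial>\<gamma>) = (\<integral>x. f x \<partial>\<mu>)" by (rule LIMSEQ_unique)
  then show "(\<integral>x. f x \<partial>distr \<gamma> borel fst) = (\<integral>x. f x \<partial>\<mu>)" by (simp add: integral_distr)
qed simp

section \<open>Strong subdifferentials\<close>

lemma borel_measurable_triple_projections [measurable]: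
  "(\<lambda>(x1, x2, x3). (x1, x2)) \<in> borel_measurable (borel :: ('a::euclidean_space \<times> 'a \<times> 'a) measure)"
  "(\<lambda>(x1, x2, x3). (x1, x3)) \<in> borel_measurable (borel :: ('a::euclidean_space \<times> 'a \<times> 'a) measure)"
  "(\<lambda>(x1, x2, x3). x3) \<in> borel_measurable (borel :: ('a::euclidean_space \<times> 'a \<times> 'a) measure)"
  unfolding case_prod_beta' by (intro borel_measurable_continuous_onI continuous_intros)+

lemma borel_measurable_tp_grad [measurable]: "tp_grad m \<in> borel_measurable borel"
  by (intro borel_measurable_continuous_onI continuous_intros)

lemma PpqD:
  assumes "\<gamma> \<in> Ppq p"
  shows "prob_space \<gamma>" "sets \<gamma> = sets borel"
     "(\<integral>\<^sup>+ z. ennreal (norm (fst z) powr p) \<partial>\<gamma>) < \<infinity>"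
     "(\<integral>\<^sup>+ z. ennreal (norm (snd z) powr conj_exp p) \<partial>\<gamma>) < \<infinity>"
  using assms by (auto simp: Ppq_def)

lemma integrable_norm_of_powr:
  fixes Y :: "'w \<Rightarrow> 'a::euclidean_space"
  assumes "prob_space M" and [measurable]: "Y \<in> borel_measurable M" and q: "q \<ge> 1"
    and fin: "(\<integral>\<^sup>+w. ennreal (norm (Y w) powr q) \<partial>M) < \<infinity>"
  shows "integrable M Y"
proof -
  interpret prob_space M by fact
  have "integrable M (\<lambda>w. norm (Y w) powr q)" using fin by (intro integrableI_bounded) auto
  then have "integrable M (\<lambda>w. 1 + norm (Y w) powr q)" by simp
  then show ?thesis
  proof (rule Bochner_Integration.integrable_bound)
    have "norm (Y w) \<le> 1 + norm (Y w) powr q" for w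
    using powr_le_one_plus_powr[of "norm (Y w)" 1 q] q by simp
    then show "AE w in M. norm (Y w) \<le> norm (1 + norm (Y w) powr q)"
      by (auto intro!: AE_I2 order_trans[OF _ abs_ge_self])
  qed simp
qed

lemma bounded_shift_Pp:
  fixes X H :: "'w \<Rightarrow> 'a::euclidean_space"
  assumes P: "prob_space M" and [measurable]: "X \<in> borel_measurable M" "H \<in> borel_measurable M" and p: "p > 0"
    and X: "(\<integral>\<^sup>+w. ennreal (norm (X w) powr p) \<partial>M) < \<infinity>" and H: "\<And>w. norm (H w) \<le> 1"
  shows "distr M borel (\<lambda>w. X w + H w) \<in> Pp p"
proof -
  interpret prob_space M by fact
  have bd: "norm (X w + H w) powr p \<le> 2 powr p * norm (X w) powr p + 2 powr p" for w
  proof -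
    have "norm (H w) powr p \<le> 1 powr p" using H p by (intro powr_mono2) auto
    then have "2 powr p * (norm (X w) powr p + norm (H w) powr p) \<le> 2 powr p * (norm (X w) powr p + 1)"
      by (intro mult_left_mono add_left_mono) auto
    then show ?thesis using norm_diff_powr_le[OF p, of "X w" "- H w"]
      unfolding distrib_left mult_1_right norm_minus_cancel diff_minus_eq_add by linarith
  qed
  have "(\<integral>\<^sup>+w. ennreal (norm (X w + H w) powr p) \<partial>M)
      \<le> (\<integral>\<^sup>+w. ennreal (2 powr p) * ennreal (norm (X w) powr p) + ennreal (2 powr p) \<partial>M)"
    using bd by (intro nn_integral_mono) (simp flip: ennreal_plus ennreal_mult'')
  also have "\<dots> = ennreal (2 powr p) * (\<integral>\<^sup>+w. ennreal (norm (X w) powr p) \<partial>M) + ennreal (2 powr p)"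
    by (simp add: nn_integral_add nn_integral_cmult emeasure_space_1)
  also have "\<dots> < \<infinity>" using X by (simp add: ennreal_mult_less_top)
  finally show ?thesis by (simp add: Pp_def prob_space_distr nn_integral_distr)
qed

text \<open>Only the displacements \<open>x\<^sub>3 = x\<^sub>1 + t\<psi>(x\<^sub>1, x\<^sub>2)\<close> with
  \<open>\<psi> = v/(1 + \<bar>v\<bar>)\<close> and \<open>v = x\<^sub>2 - grad(x\<^sub>1)\<close> are needed.\<close>

lemma strong_frechet_TP_imp_grad:
  fixes \<mu> :: "'a::euclidean_space measure"
  assumes p: "p \<ge> 2" and sf: "strong_frechet p TP \<mu> \<gamma>"
  shows "AE z in \<gamma>. snd z = tp_grad (moment \<mu>) (fst z)"
proof -
  have mu: "\<mu> \<in> Pp p" and gam: "\<gamma> \<in> Ppq p" and marg: "distr \<gamma> borel fst = \<mu>"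
    and sub: "\<And>\<epsilon>. \<epsilon> > 0 \<Longrightarrow> \<exists>\<delta>>0. \<forall>\<nu>\<in>Pp p. \<forall>\<beta>\<in>Gamma3 \<gamma> \<nu>. Cpb p \<beta> < \<delta> \<longrightarrow>
        TP \<nu> - TP \<mu> \<ge> ereal (pairing3 \<beta>) - ereal (\<epsilon> * Cpb p \<beta>)"
    using sf by (auto simp: strong_frechet_def)
  note gD = PpqD[OF gam]
  interpret prob_space \<gamma> by (rule gD)
  have [measurable_cong]: "sets \<gamma> = sets borel" by (rule gD)
  have [measurable]: "fst \<in> borel_measurable \<gamma>" "snd \<in> borel_measurable \<gamma>" by measurable
  define G where "G = tp_grad (moment \<mu>)"
  have [measurable]: "G \<in> borel_measurable borel" unfolding G_def by measurable
  define v where "v z = snd z - G (fst z)" for z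
  \<comment> \<open>The normalization keeps the direction of \<open>v\<close> and bounds its length
    by 1. The second coordinate only has a finite moment of order \<open>conj_exp p\<close>, so
    shifting by \<open>v\<close> itself might leave \<open>Pp p\<close>; a bounded shift does not,
    and it can be paired with any integrable field.\<close>
  define \<psi> where "\<psi> z = (1 / (1 + norm (v z))) *\<^sub>R v z" for z
  have [measurable]: "v \<in> borel_measurable borel" unfolding v_def by measurable
  have [measurable]: "\<psi> \<in> borel_measurable borel" unfolding \<psi>_def by measurable
  have np: "1 + norm (v z) > 0" for z by (intro add_pos_nonneg) auto
  have \<psi>1: "norm (\<psi> z) \<le> 1" for z using np[of z] by (simp add: \<psi>_def)
  have i2: "integrable \<gamma> snd"
    using p by (intro integrable_norm_of_powr[OF gD(1) _ _ gD(4)]) (auto simp: conj_exp_def field_simps)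
  have X2: "integrable \<gamma> (\<lambda>z. (norm (fst z))\<^sup>2)"
    by (rule square_integrable_of_powr[OF gD(1) _ p gD(3)]) measurable
  have X1: "integrable \<gamma> fst"
    by (rule integrable_norm_of_powr[OF gD(1) _ _ gD(3)]) (use p in auto)
  have iG: "integrable \<gamma> (\<lambda>z. G (fst z))"
    unfolding G_def tp_grad_def tp_form_def
    using X1 by (auto intro!: integrable_sum integrable_scaleR_left integrable_mult_right
        integrable_diff integrable_mult_left integrable_add integrable_divide integrable_inner_left)
  have iin: "integrable \<gamma> (\<lambda>z. Y z \<bullet> \<psi> z)" if Y: "integrable \<gamma> Y" for Y
  proof (rule Bochner_Integration.integrable_bound[OF integrable_norm[OF Y]])
    have "\<bar>Y z \<bullet> \<psi> z\<bar> \<le> norm (Y z)" for z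
      using Cauchy_Schwarz_ineq2[of "Y z" "\<psi> z"] mult_left_mono[OF \<psi>1[of z] norm_ge_zero[of "Y z"]] by simp
    then show "AE z in \<gamma>. norm (Y z \<bullet> \<psi> z) \<le> norm (norm (Y z))" by simp
    show "(\<lambda>z. Y z \<bullet> \<psi> z) \<in> borel_measurable \<gamma>"
      using borel_measurable_integrable[OF Y] by measurable
  qed
  define K where "K = (\<integral>z. (norm (fst z))\<^sup>2 \<partial>\<gamma>)"
  define C where "C = (real DIM('a)) ^ 4 * (4 * K + 2 * (K + 2)\<^sup>2)"
  have "0 \<le> K" by (simp add: K_def)
  then have C: "0 \<le> C" by (simp add: C_def)
  \<comment> \<open>After division by the step length \<open>t\<close>, one
    \<open>\<epsilon>\<close> is the error allowed by the subdifferential and the other bounds the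
    quadratic remainder of the expansion.\<close>
  have key: "(\<integral>z. v z \<bullet> \<psi> z \<partial>\<gamma>) \<le> \<epsilon> + \<epsilon>" if e: "\<epsilon> > 0" for \<epsilon>
  proof -
    obtain \<delta> where d: "\<delta> > 0" "\<And>\<nu> \<beta>. \<nu> \<in> Pp p \<Longrightarrow> \<beta> \<in> Gamma3 \<gamma> \<nu> \<Longrightarrow> Cpb p \<beta> < \<delta> \<Longrightarrow>
        TP \<nu> - TP \<mu> \<ge> ereal (pairing3 \<beta>) - ereal (\<epsilon> * Cpb p \<beta>)" using sub[OF e] by blast
    \<comment> \<open>The three terms secure the range of \<open>tp_expansion\<close>, a cost
      strictly below \<open>\<delta>\<close>, and \<open>C * t \<le> \<epsilon>\<close>; the
      denominator \<open>C + 1\<close> is positive even for \<open>C = 0\<close>.\<close>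
    define t where "t = min 1 (min (\<delta> / 2) (\<epsilon> / (C + 1)))"
    have t: "0 < t" "t \<le> 1" "t < \<delta>" "C * t \<le> \<epsilon>"
    proof -
      show "0 < t" "t \<le> 1" "t < \<delta>" using d(1) e C by (auto simp: t_def min_less_iff_disj)
      have "C * t \<le> (C + 1) * t" using \<open>0 < t\<close> by simp
      also have "\<dots> \<le> (C + 1) * (\<epsilon> / (C + 1))" using C by (intro mult_left_mono) (auto simp: t_def)
      also have "\<dots> = \<epsilon>" using C by simp
      finally show "C * t \<le> \<epsilon>" .
    qed
    define H where "H z = t *\<^sub>R \<psi> z" for z
    have [measurable]: "H \<in> borel_measurable borel" unfolding H_def by measurable
    have Ht: "norm (H z) \<le> t" for z using \<psi>1[of z] t by (simp add: H_def mult_left_le)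
    define \<nu> where "\<nu> = distr \<gamma> borel (\<lambda>z. fst z + H z)"
    define \<beta> where "\<beta> = distr \<gamma> borel (\<lambda>z. (fst z, snd z, fst z + H z))"
    have bm [measurable]: "(\<lambda>z. (fst z, snd z, fst z + H z)) \<in> borel_measurable \<gamma>" by measurable
    have H2: "(norm (H z))\<^sup>2 \<le> t\<^sup>2" for z using Ht by (intro power_mono) auto
    have iH2: "integrable \<gamma> (\<lambda>z. (norm (H z))\<^sup>2)"
      using H2 by (intro integrable_const_bound[of _ "t\<^sup>2"]) auto
    interpret pt: perturbation \<gamma> fst H t
    proof
      have "(\<integral>z. (norm (H z))\<^sup>2 \<partial>\<gamma>) \<le> (\<integral>z. t\<^sup>2 \<partial>\<gamma>)"
        using H2 iH2 by (intro integral_mono) auto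
      then show "(\<integral>z. (norm (H z))\<^sup>2 \<partial>\<gamma>) \<le> t\<^sup>2" by (simp add: prob_space)
    qed (use t X2 iH2 in auto)
    have nu: "\<nu> \<in> Pp p" unfolding \<nu>_def
      by (rule bounded_shift_Pp[OF gD(1) _ _ _ gD(3)]) (use p Ht t in \<open>auto intro: order_trans\<close>)
    have "distr \<beta> borel (\<lambda>(x1, x2, x3). (x1, x2)) = distr \<gamma> borel (\<lambda>z. z)"
      unfolding \<beta>_def by (subst distr_distr) (auto simp: comp_def)
    also have "\<dots> = \<gamma>" by (rule distr_id2) (simp add: gD)
    finally have m12: "distr \<beta> borel (\<lambda>(x1, x2, x3). (x1, x2)) = \<gamma>" .
    have m3: "distr \<beta> borel (\<lambda>(x1, x2, x3). x3) = \<nu>"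
      unfolding \<beta>_def \<nu>_def by (subst distr_distr) (auto simp: comp_def)
    have beta: "\<beta> \<in> Gamma3 \<gamma> \<nu>" unfolding Gamma3_def using m12 m3
      by (auto simp: \<beta>_def prob_space_distr)
    have "Cpb p \<beta> \<le> (t powr p) powr (1 / p)"
    proof -
      have "(\<integral>\<^sup>+z. ennreal (norm (fst z - snd (snd z)) powr p) \<partial>\<beta>) = (\<integral>\<^sup>+z. ennreal (norm (H z) powr p) \<partial>\<gamma>)"
        unfolding \<beta>_def by (subst nn_integral_distr) auto
      also have "\<dots> \<le> (\<integral>\<^sup>+z. ennreal (t powr p) \<partial>\<gamma>)"
        using Ht p by (intro nn_integral_mono ennreal_leI powr_mono2) auto
      also have "\<dots> = ennreal (t powr p)" by (simp add: emeasure_space_1)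
      finally have "enn2real (\<integral>\<^sup>+z. ennreal (norm (fst z - snd (snd z)) powr p) \<partial>\<beta>) \<le> t powr p"
        by (intro enn2real_leI) auto
      then show ?thesis unfolding Cpb_def using p by (intro powr_mono2) auto
    qed
    then have Cp: "Cpb p \<beta> \<le> t" using t p by (simp add: powr_powr)
    have pair: "pairing3 \<beta> = t * (\<integral>z. snd z \<bullet> \<psi> z \<partial>\<gamma>)"
      unfolding pairing3_def \<beta>_def by (subst integral_distr) (auto simp: H_def)
    have "TP \<nu> - TP \<mu> \<ge> ereal (pairing3 \<beta>) - ereal (\<epsilon> * Cpb p \<beta>)"
      by (rule d(2)[OF nu beta]) (use Cp t in auto)
    then have "pairing3 \<beta> - \<epsilon> * Cpb p \<beta> \<le> tp_form (moment \<nu>) (moment \<nu>) - tp_form (moment \<mu>) (moment \<mu>)"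
      unfolding TP_Pp[OF p nu] TP_Pp[OF p mu] by simp
    moreover have "\<epsilon> * Cpb p \<beta> \<le> \<epsilon> * t" using Cp e by simp
    moreover have "\<bar>tp_form (moment \<nu>) (moment \<nu>) - tp_form (moment \<mu>) (moment \<mu>)
        - t * (\<integral>z. G (fst z) \<bullet> \<psi> z \<partial>\<gamma>)\<bar> \<le> C * t\<^sup>2"
      using pt.tp_expansion[OF t(2)] unfolding marg \<nu>_def[symmetric] K_def[symmetric] C_def[symmetric] G_def[symmetric]
      by (simp add: H_def)
    moreover have "(\<integral>z. v z \<bullet> \<psi> z \<partial>\<gamma>) = (\<integral>z. snd z \<bullet> \<psi> z \<partial>\<gamma>) - (\<integral>z. G (fst z) \<bullet> \<psi> z \<partial>\<gamma>)"
      using iin[OF i2] iin[OF iG] by (simp add: v_def inner_diff_left)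
    ultimately have "t * (\<integral>z. v z \<bullet> \<psi> z \<partial>\<gamma>) \<le> \<epsilon> * t + C * t\<^sup>2"
      unfolding pair by (simp add: right_diff_distrib)
    also have "\<dots> \<le> t * (\<epsilon> + \<epsilon>)"
      using mult_left_mono[OF t(4), of t] t(1) by (simp add: power2_eq_square algebra_simps)
    finally show ?thesis using t(1) by simp
  qed
  have le0: "(\<integral>z. v z \<bullet> \<psi> z \<partial>\<gamma>) \<le> 0"
  proof (rule field_le_epsilon)
    show "(\<integral>z. v z \<bullet> \<psi> z \<partial>\<gamma>) \<le> 0 + e" if "e > 0" for e using key[of "e / 2"] that by simp
  qed
  \<comment> \<open>In this form the integrand is nonnegative and vanishes only where
    \<open>v\<close> does, so the bound \<open>le0\<close> forces \<open>v\<close> to vanish almost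
    everywhere.\<close>
  have vpsi: "v z \<bullet> \<psi> z = (norm (v z))\<^sup>2 / (1 + norm (v z))" for z
    by (simp add: \<psi>_def power2_norm_eq_inner)
  have nn: "0 \<le> v z \<bullet> \<psi> z" for z unfolding vpsi using np[of z] by simp
  have iv: "integrable \<gamma> (\<lambda>z. v z \<bullet> \<psi> z)"
    by (rule iin) (use i2 iG in \<open>simp add: v_def\<close>)
  have "(\<integral>z. v z \<bullet> \<psi> z \<partial>\<gamma>) = 0" using le0 nn by (intro antisym Bochner_Integration.integral_nonneg) auto
  then have "AE z in \<gamma>. v z \<bullet> \<psi> z = 0"
    using integral_nonneg_eq_0_iff_AE[OF iv] nn by auto
  then show ?thesis
  proof eventually_elim
    case (elim z)
    then have "v z = 0" unfolding vpsi using np[of z] by simp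
    then show ?case by (simp add: v_def G_def)
  qed
qed

text \<open>The truncated distance \<open>f\<close> to the limiting graph is a legitimate narrow
  test function. Under \<open>\<gamma>s n\<close> it measures only the gap between two gradient
  fields, which the moment differences control after integration against the first marginal.\<close>

lemma narrow_limit_grad:
  fixes \<mu>s :: "nat \<Rightarrow> 'a::euclidean_space measure"
  assumes p: "p \<ge> 2" and conv: "conv_Pp p \<mu>s \<mu>" and narrow: "narrow_conv \<gamma>s \<gamma>"
    and marg: "\<And>n. distr (\<gamma>s n) borel fst = \<mu>s n"
    and grad: "\<And>n. AE z in \<gamma>s n. snd z = tp_grad (moment (\<mu>s n)) (fst z)"
  shows "AE z in \<gamma>. snd z = tp_grad (moment \<mu>) (fst z)"
proof -
  have \<gamma>: "prob_space \<gamma>" "sets \<gamma> = sets borel" "\<And>n. prob_space (\<gamma>s n)" "\<And>n. sets (\<gamma>s n) = sets borel"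
    using narrow by (auto simp: narrow_conv_def)
  interpret prob_space \<gamma> by fact
  have [measurable_cong]: "sets \<gamma> = sets borel" by fact
  have m: "\<mu>s n \<in> Pp p" "\<mu> \<in> Pp p" for n using conv by (auto simp: conv_Pp_def)
  define f where "f z = min 1 (norm (snd z - tp_grad (moment \<mu>) (fst z)))" for z :: "'a \<times> 'a"
  have fc: "continuous_on UNIV f" unfolding f_def by (intro continuous_intros)
  have fm [measurable]: "f \<in> borel_measurable borel" using fc by (rule borel_measurable_continuous_onI)
  have f01: "0 \<le> f z" "f z \<le> 1" for z by (auto simp: f_def)
  have "bounded (range f)" using f01 by (auto simp: bounded_iff intro!: exI[of _ 1])
  then have lim: "(\<lambda>n. \<integral>z. f z \<partial>\<gamma>s n) \<longlonglongrightarrow> (\<integral>z. f z \<partial>\<gamma>)"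
    using narrow fc unfolding narrow_conv_def by blast
  define E where "E n = entry_sum (\<lambda>b c. moment (\<mu>s n) b c - moment \<mu> b c)" for n
  \<comment> \<open>The trace of the moment matrix is the integral of the squared norm, so it
    converges together with the moments.\<close>
  define T where "T n = (\<Sum>b\<in>Basis. moment (\<mu>s n) b b)" for n
  define D where "D = 8 * (real DIM('a))\<^sup>2"
  have est: "\<bar>\<integral>z. f z \<partial>\<gamma>s n\<bar> \<le> D * E n * (1 + T n)" for n
  proof -
    interpret gn: prob_space "\<gamma>s n" by (rule \<gamma>)
    have [measurable_cong]: "sets (\<gamma>s n) = sets borel" by (rule \<gamma>)
    have [measurable]: "fst \<in> borel_measurable (\<gamma>s n)" by measurable
    have [measurable_cong]: "sets (\<mu>s n) = sets borel" by (rule PpD(2)[OF m(1)])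
    have sq: "integrable (\<mu>s n) (\<lambda>x. (norm x)\<^sup>2)" by (rule Pp_square_integrable[OF p m(1)])
    have sqg: "integrable (\<gamma>s n) (\<lambda>z. (norm (fst z))\<^sup>2)"
      using sq unfolding marg[symmetric] by (simp add: integrable_distr_eq)
    have "(\<integral>z. (norm (fst z))\<^sup>2 \<partial>\<gamma>s n) = (\<integral>x. (norm x)\<^sup>2 \<partial>\<mu>s n)"
      unfolding marg[symmetric] by (simp add: integral_distr)
    also have "\<dots> = (\<integral>x. (\<Sum>b\<in>Basis. (x \<bullet> b) * (x \<bullet> b)) \<partial>\<mu>s n)"
      unfolding power2_norm_eq_inner by (subst euclidean_inner) simp
    also have "\<dots> = T n" unfolding T_def moment_def
    proof (rule Bochner_Integration.integral_sum)
      fix b :: 'a assume b: "b \<in> Basis"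
      show "integrable (\<mu>s n) (\<lambda>x. (x \<bullet> b) * (x \<bullet> b))"
        by (rule integrable_coord_mult) (use sq b in auto)
    qed
    finally have T: "(\<integral>z. (norm (fst z))\<^sup>2 \<partial>\<gamma>s n) = T n" .
    have DE: "0 \<le> D * E n" by (simp add: D_def E_def entry_sum_nonneg)
    have "(\<integral>z. f z \<partial>\<gamma>s n) \<le> (\<integral>z. D * E n * (1 + (norm (fst z))\<^sup>2) \<partial>\<gamma>s n)"
    proof (rule integral_mono_AE)
      show "integrable (\<gamma>s n) f" using f01 by (intro gn.integrable_const_bound[of _ 1]) auto
      show "integrable (\<gamma>s n) (\<lambda>z. D * E n * (1 + (norm (fst z))\<^sup>2))" using sqg by simp
      show "AE z in \<gamma>s n. f z \<le> D * E n * (1 + (norm (fst z))\<^sup>2)"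
        using grad[of n]
      proof eventually_elim
        case (elim z)
        have "f z \<le> norm (tp_grad (moment (\<mu>s n)) (fst z) - tp_grad (moment \<mu>) (fst z))"
          by (simp add: f_def elim)
        also have "\<dots> \<le> D * E n * norm (fst z)"
          unfolding tp_grad_diff D_def E_def by (rule norm_tp_grad_le)
        also have "\<dots> \<le> D * E n * (1 + (norm (fst z))\<^sup>2)"
        proof (rule mult_left_mono[OF _ DE])
          show "norm (fst z) \<le> 1 + (norm (fst z))\<^sup>2"
            using sum_squares_bound[of "norm (fst z)" 1] norm_ge_zero[of "fst z"]
            unfolding one_power2 mult_1_right by linarith
        qed
        finally show ?case .
      qed
    qed
    also have "\<dots> = D * E n * (1 + T n)" using sqg T by (simp add: gn.prob_space)
    finally show ?thesis using f01 by (simp add: integral_nonneg_AE)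
  qed
  have "(\<lambda>n. D * E n * (1 + T n)) \<longlonglongrightarrow> D * (\<Sum>b\<in>(Basis::'a set). \<Sum>c\<in>(Basis::'a set). \<bar>moment \<mu> b c - moment \<mu> b c\<bar>) * (1 + (\<Sum>b\<in>Basis. moment \<mu> b b))"
    unfolding E_def T_def entry_sum_def by (intro tendsto_intros moment_tendsto[OF p conv]) auto
  then have "(\<lambda>n. D * E n * (1 + T n)) \<longlonglongrightarrow> 0" by simp
  then have "(\<lambda>n. \<integral>z. f z \<partial>\<gamma>s n) \<longlonglongrightarrow> 0"
    by (rule Lim_null_comparison[rotated]) (simp add: est)
  then have "(\<integral>z. f z \<partial>\<gamma>) = 0" using lim by (rule LIMSEQ_unique[rotated])
  moreover have "integrable \<gamma> f" using f01 by (intro integrable_const_bound[of _ 1]) auto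
  ultimately have "AE z in \<gamma>. f z = 0" using f01 by (simp add: integral_nonneg_eq_0_iff_AE)
  then show ?thesis by eventually_elim (auto simp: f_def min_def split: if_splits)
qed

section \<open>Regularity\<close>

text \<open>The plan is recovered from its first marginal and the field alone, which allows
  couplings to be lifted without gluing along conditional measures.\<close>

lemma graph_of_AE:
  fixes \<gamma> :: "('a::euclidean_space \<times> 'a) measure"
  assumes S: "sets \<gamma> = sets borel" and marg: "distr \<gamma> borel fst = \<mu>"
    and [measurable]: "G \<in> borel_measurable borel" and ae: "AE z in \<gamma>. snd z = G (fst z)"
  shows "\<gamma> = distr \<mu> borel (\<lambda>x. (x, G x))"
proof -
  have [measurable_cong]: "sets \<gamma> = sets borel" by (rule S)
  have [measurable]: "fst \<in> borel_measurable \<gamma>" by measurable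
  have "\<gamma> = distr \<gamma> borel (\<lambda>z. z)" by (rule distr_id2[symmetric]) (simp add: S)
  also have "\<dots> = distr \<gamma> borel (\<lambda>z. (fst z, G (fst z)))"
  proof (rule distr_cong_AE)
    show "AE z in \<gamma>. z = (fst z, G (fst z))" using ae by eventually_elim (simp add: prod_eq_iff)
  qed (auto simp: S)
  also have "\<dots> = distr (distr \<gamma> borel fst) borel (\<lambda>x. (x, G x))"
    by (subst distr_distr) (auto simp: comp_def)
  finally show ?thesis by (simp add: marg)
qed

text \<open>The field grows linearly, and \<open>p \<ge> 2\<close> gives
  \<open>conj_exp p \<le> p\<close>, so the p-th moment of the first marginal controls the second
  coordinate.\<close>

lemma grad_graph_Ppq:
  fixes \<gamma> :: "('a::euclidean_space \<times> 'a) measure"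
  assumes p: "p \<ge> 2" and mu: "\<mu> \<in> Pp p" and P: "prob_space \<gamma>" and S: "sets \<gamma> = sets borel"
    and marg: "distr \<gamma> borel fst = \<mu>" and ae: "AE z in \<gamma>. snd z = tp_grad m (fst z)"
  shows "\<gamma> \<in> Ppq p"
proof -
  interpret prob_space \<gamma> by (rule P)
  have [measurable_cong]: "sets \<gamma> = sets borel" by (rule S)
  have [measurable]: "fst \<in> borel_measurable \<gamma>" by measurable
  define q where "q = conj_exp p"
  have q: "0 < q" "q \<le> p" using p by (auto simp: q_def conj_exp_def field_simps) 
  have fin: "(\<integral>\<^sup>+z. ennreal (norm (fst z) powr p) \<partial>\<gamma>) < \<infinity>"
    using PpD(3)[OF mu] unfolding marg[symmetric] by (simp add: nn_integral_distr)
  define B where "B = 8 * (real DIM('a))\<^sup>2 * entry_sum m"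
  have B: "0 \<le> B" by (simp add: B_def entry_sum_nonneg)
  have bd: "norm (tp_grad m x) powr q \<le> B powr q + B powr q * norm x powr p" for x :: 'a
  proof -
    have "norm (tp_grad m x) powr q \<le> (B * norm x) powr q"
      using q norm_tp_grad_le[of m x] by (intro powr_mono2) (auto simp: B_def)
    also have "\<dots> = B powr q * norm x powr q" using B by (simp add: powr_mult)
    also have "\<dots> \<le> B powr q * (1 + norm x powr p)"
      using q by (intro mult_left_mono powr_le_one_plus_powr) auto
    finally show ?thesis by (simp add: distrib_left)
  qed
  have "(\<integral>\<^sup>+z. ennreal (norm (snd z) powr q) \<partial>\<gamma>) = (\<integral>\<^sup>+z. ennreal (norm (tp_grad m (fst z)) powr q) \<partial>\<gamma>)"
    using ae by (intro nn_integral_cong_AE) auto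
  also have "\<dots> \<le> (\<integral>\<^sup>+z. ennreal (B powr q) + ennreal (B powr q) * ennreal (norm (fst z) powr p) \<partial>\<gamma>)"
    using bd by (intro nn_integral_mono) (simp flip: ennreal_plus ennreal_mult'')
  also have "\<dots> = ennreal (B powr q) + ennreal (B powr q) * (\<integral>\<^sup>+z. ennreal (norm (fst z) powr p) \<partial>\<gamma>)"
    by (simp add: nn_integral_add nn_integral_cmult emeasure_space_1)
  also have "\<dots> < \<infinity>" using fin by (simp add: ennreal_mult_less_top)
  finally show ?thesis using P S fin by (simp add: Ppq_def q_def)
qed

text \<open>For a plan on a graph, the middle coordinate is a function of the first and can be
  inserted into any coupling. The projection to the outer coordinates gives back
  \<open>\<pi>\<close>, so optimality is inherited.\<close>

lemma optimal_graph_coupling: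
  fixes \<mu> \<nu> :: "'a::euclidean_space measure"
  assumes c: "\<pi> \<in> optimal_couplings p \<mu> \<nu>" and [measurable]: "G \<in> borel_measurable borel"
    and \<gamma>: "\<gamma> = distr \<mu> borel (\<lambda>x. (x, G x))"
  shows "distr \<pi> borel (\<lambda>z. (fst z, G (fst z), snd z)) \<in> Gamma3_0 p \<gamma> \<nu>"
    "pairing3 (distr \<pi> borel (\<lambda>z. (fst z, G (fst z), snd z))) = (\<integral>z. G (fst z) \<bullet> (snd z - fst z) \<partial>\<pi>)"
proof -
  have cc: "\<pi> \<in> couplings \<mu> \<nu>" using c by (simp add: optimal_couplings_def)
  note cD = couplingsD[OF cc]
  interpret prob_space \<pi> by (rule cD)
  have [measurable_cong]: "sets \<pi> = sets borel" by (rule cD)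
  have [measurable]: "fst \<in> borel_measurable \<pi>" "snd \<in> borel_measurable \<pi>" by measurable
  define \<beta> where "\<beta> = distr \<pi> borel (\<lambda>z. (fst z, G (fst z), snd z))"
  have "distr \<beta> borel (\<lambda>(x1, x2, x3). (x1, x2)) = distr (distr \<pi> borel fst) borel (\<lambda>x. (x, G x))"
    unfolding \<beta>_def by (subst (1 2) distr_distr) (auto simp: comp_def)
  then have m12: "distr \<beta> borel (\<lambda>(x1, x2, x3). (x1, x2)) = \<gamma>" by (simp add: cD \<gamma>)
  have m3: "distr \<beta> borel (\<lambda>(x1, x2, x3). x3) = \<nu>"
    unfolding \<beta>_def cD(4)[symmetric] by (subst distr_distr) (auto simp: comp_def)
  have "distr \<beta> borel (\<lambda>(x1, x2, x3). (x1, x3)) = distr \<pi> borel (\<lambda>z. z)"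
    unfolding \<beta>_def by (subst distr_distr) (auto simp: comp_def)
  also have "\<dots> = \<pi>" by (rule distr_id2) (simp add: cD)
  finally have m13: "distr \<beta> borel (\<lambda>(x1, x2, x3). (x1, x3)) = \<pi>" .
  have "sets \<mu> = sets borel" unfolding cD(3)[symmetric] by simp
  then have [measurable_cong]: "sets \<mu> = sets borel" .
  have "distr \<gamma> borel fst = distr \<mu> borel (\<lambda>x. x)"
    unfolding \<gamma> by (subst distr_distr) (auto simp: comp_def)
  also have "\<dots> = \<mu>" by (rule distr_id2) (simp add: \<open>sets \<mu> = sets borel\<close>)
  finally have "distr \<gamma> borel fst = \<mu>" .
  then have "\<beta> \<in> Gamma3_0 p \<gamma> \<nu>" unfolding Gamma3_0_def Gamma3_def
    using m12 m3 m13 c by (auto simp: \<beta>_def prob_space_distr)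
  then show "distr \<pi> borel (\<lambda>z. (fst z, G (fst z), snd z)) \<in> Gamma3_0 p \<gamma> \<nu>" by (simp add: \<beta>_def)
  show "pairing3 (distr \<pi> borel (\<lambda>z. (fst z, G (fst z), snd z))) = (\<integral>z. G (fst z) \<bullet> (snd z - fst z) \<partial>\<pi>)"
    unfolding pairing3_def by (subst integral_distr) auto
qed

text \<open>The infimum is at most the pairing of one lifted optimal coupling, and that pairing is
  exactly the gradient term of the expansion.\<close>

lemma grad_in_ext_subdiff_TP:
  fixes \<mu> :: "'a::euclidean_space measure"
  assumes p: "p \<ge> 2" and mu: "\<mu> \<in> Pp p" and P: "prob_space \<gamma>" and S: "sets \<gamma> = sets borel"
    and marg: "distr \<gamma> borel fst = \<mu>" and ae: "AE z in \<gamma>. snd z = tp_grad (moment \<mu>) (fst z)"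
  shows "\<gamma> \<in> ext_subdiff p TP \<mu>"
  unfolding ext_subdiff_def
proof (intro CollectI conjI allI impI)
  show "\<mu> \<in> Pp p" by (rule mu)
  show "TP \<mu> < \<infinity>" by (simp add: TP_def)
  show "\<gamma> \<in> Ppq p" by (rule grad_graph_Ppq[OF p mu P S marg ae])
  show "distr \<gamma> borel fst = \<mu>" by (rule marg)
  define K where "K = (\<integral>x. (norm x)\<^sup>2 \<partial>\<mu>)"
  \<comment> \<open>Twice the constant of \<open>tp_expansion\<close>, since its scale is
    \<open>sqrt 2 * W\<close>.\<close>
  define C where "C = 2 * ((real DIM('a)) ^ 4 * (4 * K + 2 * (K + 2)\<^sup>2))"
  have "0 \<le> K" by (simp add: K_def)
  then have C: "0 \<le> C" by (simp add: C_def)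
  fix \<epsilon> :: real assume e: "\<epsilon> > 0"
  \<comment> \<open>The bound 1/2 ensures \<open>sqrt 2 * W \<le> 1\<close>; the other turns the
    quadratic remainder \<open>C * W\<^sup>2\<close> into at most
    \<open>\<epsilon> * W\<close>.\<close>
  define \<delta> where "\<delta> = min (1/2) (\<epsilon> / (C + 1))"
  have "\<delta> > 0" using e C by (simp add: \<delta>_def)
  moreover have "TP \<nu> - TP \<mu> \<ge> (INF \<beta>\<in>Gamma3_0 p \<gamma> \<nu>. ereal (pairing3 \<beta>)) - ereal (\<epsilon> * Wp p \<mu> \<nu>)"
    if nu: "\<nu> \<in> Pp p" and w: "Wp p \<mu> \<nu> < \<delta>" for \<nu>
  proof -
    obtain \<pi> where opt: "\<pi> \<in> optimal_couplings p \<mu> \<nu>"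
      and cost: "transport_cost p \<pi> = ennreal (Wp p \<mu> \<nu> powr p)"
      using optimal_coupling_exists[OF _ mu nu] p by (metis less_le_trans zero_less_numeral)
    have cc: "\<pi> \<in> couplings \<mu> \<nu>" using opt by (simp add: optimal_couplings_def)
    define A where "A = (\<integral>z. tp_grad (moment \<mu>) (fst z) \<bullet> (snd z - fst z) \<partial>\<pi>)"
    define D where "D = tp_form (moment \<nu>) (moment \<nu>) - tp_form (moment \<mu>) (moment \<mu>)"
    have K_eq: "(\<integral>z. (norm (fst z))\<^sup>2 \<partial>\<pi>) = K"
      unfolding K_def by (rule coupling_distr(1)[OF cc]) simp
    have est: "A - D \<le> C * W\<^sup>2" if W: "Wp p \<mu> \<nu> \<le> W" "0 < W" "W \<le> 1/2" for W
    proof -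
      interpret pt: perturbation \<pi> fst "\<lambda>z. snd z - fst z" "sqrt 2 * W"
        by (rule optimal_perturbation(1)[OF p mu nu cc cost W(1,2)])
      have "sqrt 2 * W \<le> 2 * (1/2)" using W by (intro mult_mono) (auto simp: real_le_lsqrt)
      then have "sqrt 2 * W \<le> 1" by simp
      from pt.tp_expansion[OF this] show ?thesis
        unfolding coupling_distr_add(1)[OF cc] couplingsD(3)[OF cc] K_eq A_def[symmetric] D_def[symmetric]
        by (simp add: C_def power_mult_distrib abs_le_iff)
    qed
    have w0: "0 \<le> Wp p \<mu> \<nu>" by (simp add: Wp_def)
    \<comment> \<open>The estimate needs a positive scale, but the distance may be 0. If it lies
      below a small positive \<open>v\<close>, the scale \<open>v\<close> is used and its
      contribution is absorbed by the slack \<open>e'\<close>.\<close>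
    have "A - D \<le> \<epsilon> * Wp p \<mu> \<nu>"
    proof (rule field_le_epsilon)
      fix e' :: real assume e': "e' > 0"
      define v where "v = min (1/2) (e' / (C + 1))"
      have v: "0 < v" "v \<le> 1/2"
        unfolding v_def using e' C by (simp, intro min.cobounded1)
      have Cv: "C * x\<^sup>2 \<le> y * x" if "0 \<le> x" "x \<le> y / (C + 1)" for x y
      proof -
        have "C * x \<le> (C + 1) * x" using that by (simp add: algebra_simps)
        also have "\<dots> \<le> y" using that C by (simp add: field_simps)
        finally have "C * x * x \<le> y * x" using that(1) by (rule mult_right_mono)
        then show ?thesis by (simp add: power2_eq_square mult.assoc)
      qed
      show "A - D \<le> \<epsilon> * Wp p \<mu> \<nu> + e'"
      proof (cases "v \<le> Wp p \<mu> \<nu>")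
        case True
        then have "A - D \<le> C * (Wp p \<mu> \<nu>)\<^sup>2" using w v by (intro est) (auto simp: \<delta>_def)
        also have "\<dots> \<le> \<epsilon> * Wp p \<mu> \<nu>" using w w0 by (intro Cv) (auto simp: \<delta>_def)
        finally show ?thesis using e' by simp
      next
        case False
        then have "A - D \<le> C * v\<^sup>2" using v by (intro est) auto
        also have "\<dots> \<le> e' * v" using v by (intro Cv) (auto simp: v_def)
        also have "\<dots> \<le> e'" using v e' by (simp add: mult_left_le)
        finally show ?thesis using mult_nonneg_nonneg[of \<epsilon> "Wp p \<mu> \<nu>"] e w0 by linarith
      qed
    qed
    then have le: "A - \<epsilon> * Wp p \<mu> \<nu> \<le> D" by linarith
    note gr = optimal_graph_coupling[OF opt borel_measurable_tp_grad graph_of_AE[OF S marg borel_measurable_tp_grad ae]]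
    have "(INF \<beta>\<in>Gamma3_0 p \<gamma> \<nu>. ereal (pairing3 \<beta>)) \<le> ereal A"
      using INF_lower[OF gr(1), of "\<lambda>\<beta>. ereal (pairing3 \<beta>)"] unfolding gr(2) A_def .
    then have "(INF \<beta>\<in>Gamma3_0 p \<gamma> \<nu>. ereal (pairing3 \<beta>)) - ereal (\<epsilon> * Wp p \<mu> \<nu>) \<le> ereal A - ereal (\<epsilon> * Wp p \<mu> \<nu>)"
      by (rule ereal_minus_mono) simp
    also have "\<dots> \<le> TP \<nu> - TP \<mu>"
      using le unfolding TP_Pp[OF p nu] TP_Pp[OF p mu] D_def by simp
    finally show ?thesis .
  qed
  ultimately show "\<exists>\<delta>>0. \<forall>\<nu>\<in>Pp p. Wp p \<mu> \<nu> < \<delta> \<longrightarrow>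
      TP \<nu> - TP \<mu> \<ge> (INF \<beta>\<in>Gamma3_0 p \<gamma> \<nu>. ereal (pairing3 \<beta>)) - ereal (\<epsilon> * Wp p \<mu> \<nu>)" by blast
qed

theorem mainTheorem8:
  fixes p :: real
  assumes "p \<ge> 2"
  shows "regular_functional p (TP :: 'a::euclidean_space measure \<Rightarrow> ereal)"
  unfolding regular_functional_def
proof (intro conjI allI impI; (elim conjE)?)
  show "proper_lsc p (TP :: 'a measure \<Rightarrow> ereal)" by (rule proper_lsc_TP[OF assms])
  fix \<mu>s \<gamma>s c \<gamma> and \<mu> :: "'a measure"
  assume sf: "\<forall>n. strong_frechet p TP (\<mu>s n) (\<gamma>s n)" and lim: "(\<lambda>n. TP (\<mu>s n)) \<longlonglongrightarrow> ereal c"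
    and conv: "conv_Pp p \<mu>s \<mu>" and narrow: "narrow_conv \<gamma>s \<gamma>"
  have marg: "distr (\<gamma>s n) borel fst = \<mu>s n" for n using sf by (simp add: strong_frechet_def)
  have grad: "AE z in \<gamma>s n. snd z = tp_grad (moment (\<mu>s n)) (fst z)" for n
    using sf by (intro strong_frechet_TP_imp_grad[OF assms]) simp
  show "\<gamma> \<in> ext_subdiff p TP \<mu>"
  proof (rule grad_in_ext_subdiff_TP[OF assms])
    show "\<mu> \<in> Pp p" using conv by (simp add: conv_Pp_def)
    show "prob_space \<gamma>" "sets \<gamma> = sets borel" using narrow by (auto simp: narrow_conv_def)
    show "distr \<gamma> borel fst = \<mu>" by (rule narrow_marginal[OF assms conv narrow marg])
    show "AE z in \<gamma>. snd z = tp_grad (moment \<mu>) (fst z)"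
      by (rule narrow_limit_grad[OF assms conv narrow marg grad])
  qed
  show "ereal c = TP \<mu>" by (rule LIMSEQ_unique[OF lim TP_tendsto[OF assms conv]])
qed

end
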